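(* Let $d\in\mathbb{N}$, $\varepsilon>0$, $A\in\mathbb{R}^{d\times d}$, $F\in C^3(\mathbb{R}^d,\mathbb{R}^d)$, $m_0\in\mathbb{R}^d$, $\Sigma_0\in\mathbb{R}^{d\times d}$ symmetric positive definite, and $y_\tau\in\mathbb{R}^d$ for $\tau\ge0$; let $G_\tau,I_\tau,\mu^{y_\tau},\mathcal{L}_{\mu^{y_\tau}}$ be as in the context. Suppose there is $\tau_0>0$ such that: (1) for all $\tau\in[0,\tau_0]$, $I_\tau$ has a unique minimizer $\hat x_\tau$ with $D^2I_\tau(\hat x_\tau)$ positive definite; moreover $y_\tau$, $\hat x_\tau$ and $\Sigma_\tau:=D^2I_\tau(\hat x_\tau)^{-1}$ converge as $\tau\to0$, and $\lim_{\tau\to0}\Sigma_\tau$ is positive definite; (2) there are constants $C_0,C_1,C_2,C_3>0$ such that $\|D^jF(x)\|_{\Sigma_\tau}\le C_j$ for $j=0,\dots,3$, all $x\in\mathbb{R}^d$ and all $\tau\in[0,\tau_0]$, and there is $M>0$ such that $D^3F\equiv0$ on $\mathbb{R}^d\setminus B(M)$. Then there exists $\tau_1\in(0,\tau_0]$ such that $$d_{\mathrm{TV}}(\mu^{y_\tau},\mathcal{L}_{\mu^{y_\tau}})\le C(1+\varepsilon)\varepsilon^{1/2}\left(V(\tau)\tau+\frac W2\tau^2\right)\qquad\text{for all }\tau\in[0,\tau_1],$$ where $$C:=\frac23\sqrt2\,e\,\frac{\Gamma(\frac d2+\frac32)}{\Gamma(\frac d2)},\quad V(\tau):=C_3(\|A\|M+|y_\tau|)+3C_2\|A\Sigma_\tau^{1/2}\|,\quad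 W:=C_3C_0+3C_2C_1.$$ Moreover, $\{V(\tau)\}_{\tau\in[0,\tau_1]}$ is bounded.
   Context: $|\cdot|$ is the Euclidean norm on $\mathbb{R}^d$, $\|\cdot\|$ of a matrix is the operator (spectral) norm, and $B(r)\subset\mathbb{R}^d$ is the closed Euclidean ball of radius $r$ around the origin. For symmetric positive definite $\Sigma$, $\|x\|_\Sigma:=|\Sigma^{-1/2}x|$. For $F:\mathbb{R}^d\to\mathbb{R}^d$, $\|D^jF(x)\|_\Sigma:=\sup\{|D^jF(x)(h_1,\dots,h_j)|:\|h_1\|_\Sigma,\dots,\|h_j\|_\Sigma\le1\}$, with $\|D^0F(x)\|_\Sigma=|F(x)|$. The forward map is $G_\tau(x):=Ax+\tau F(x)$ for $\tau\ge0$; the prior is $\mathcal{N}(m_0,\Sigma_0)$; and $$I_\tau(x):=\frac12|Ax+\tau F(x)-y_\tau|^2+\frac\varepsilon2\|x-m_0\|_{\Sigma_0}^2+c_\tau,$$ where the constant $c_\tau\in\mathbb{R}$ is such that $\min I_\tau=0$. The posterior $\mu^{y_\tau}$ is the probability measure on $\mathbb{R}^d$ with Lebesgue density proportional to $\exp(-\frac1\varepsilon I_\tau(x))$, and its Laplace approximation is $\mathcal{L}_{\mu^{y_\tau}}:=\mathcal{N}(\hat x_\tau,\varepsilon\Sigma_\tau)$. Total variation distance: $d_{\mathrm{TV}}(\nu,\mu):=\sup_{A\in\mathcal{B}(\mathbb{R}^d)}|\nu(A)-\mu(A)|$. *)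

theory Defs
  imports "HOL-Analysis.Analysis"
begin

text \<open>The dimension d is \<open>CARD('n)\<close>, and \<open>real^'n\<close> carries the Euclidean norm.\<close>

definition sym_pos_def :: "real^'n^'n \<Rightarrow> bool" where
  "sym_pos_def S \<longleftrightarrow> transpose S = S \<and> (\<forall>x. x \<noteq> 0 \<longrightarrow> 0 < x \<bullet> (S *v x))"

text \<open>Only meaningful for symmetric positive definite \<open>S\<close>, which has exactly one such root.\<close>

definition matrix_sqrt :: "real^'n^'n \<Rightarrow> real^'n^'n" where
  "matrix_sqrt S = (THE B. sym_pos_def B \<and> B ** B = S)"

definition weighted_norm :: "real^'n^'n \<Rightarrow> real^'n \<Rightarrow> real" where
  "weighted_norm S x = norm (matrix_inv (matrix_sqrt S) *v x)"

definition op_norm :: "real^'n^'n \<Rightarrow> real" where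
  "op_norm A = onorm (\<lambda>x. A *v x)"

text \<open>\<open>iter_deriv f [h\<^sub>1, \<dots>, h\<^sub>j] x\<close> is the value of the \<open>j\<close>-linear map \<open>D\<^sup>jf(x)\<close>
  at \<open>(h\<^sub>1, \<dots>, h\<^sub>j)\<close>, provided \<open>f\<close> is \<open>j\<close> times differentiable.\<close>

primrec iter_deriv ::
    "('a::euclidean_space \<Rightarrow> 'b::euclidean_space) \<Rightarrow> 'a list \<Rightarrow> 'a \<Rightarrow> 'b" where
  "iter_deriv f [] = f"
| "iter_deriv f (h # hs) = (\<lambda>x. frechet_derivative (iter_deriv f hs) (at x) h)"

text \<open>Class \<open>C\<^sup>k\<close> on the whole space. Requiring every map \<open>x \<mapsto> Df(x)h\<close> to be of class \<open>C\<^sup>k\<close> is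
  the same as requiring \<open>x \<mapsto> Df(x)\<close> to be so, because the domain is finite-dimensional.\<close>

primrec C_class :: "nat \<Rightarrow> ('a::euclidean_space \<Rightarrow> 'b::euclidean_space) \<Rightarrow> bool" where
  "C_class 0 f \<longleftrightarrow> continuous_on UNIV f"
| "C_class (Suc k) f \<longleftrightarrow>
     (\<forall>x. f differentiable at x) \<and> (\<forall>h. C_class k (\<lambda>x. frechet_derivative f (at x) h))"

text \<open>The norm \<open>\<parallel>D\<^sup>jF(x)\<parallel>\<^sub>S\<close>. For symmetric positive definite \<open>S\<close> and \<open>F\<close> of class \<open>C\<^sup>j\<close> the set
  is bounded, so that the real supremum is the true one; for \<open>j = 0\<close> it is \<open>{norm (F x)}\<close>.\<close>

definition deriv_norm ::
    "nat \<Rightarrow> (real^'n \<Rightarrow> real^'n) \<Rightarrow> real^'n^'n \<Rightarrow> real^'n \<Rightarrow> real" where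
  "deriv_norm j F S x =
     Sup {norm (iter_deriv F hs x) | hs. length hs = j \<and> (\<forall>h\<in>set hs. weighted_norm S h \<le> 1)}"

definition hessian :: "(real^'n \<Rightarrow> real) \<Rightarrow> real^'n \<Rightarrow> real^'n^'n" where
  "hessian f x = (\<chi> i j. iter_deriv f [axis i 1, axis j 1] x)"

definition forward_map ::
    "real^'n^'n \<Rightarrow> (real^'n \<Rightarrow> real^'n) \<Rightarrow> real \<Rightarrow> real^'n \<Rightarrow> real^'n" where
  "forward_map A F \<tau> x = A *v x + \<tau> *\<^sub>R F x"

text \<open>The function \<open>I\<^sub>\<tau>\<close>, with data \<open>y\<close> and additive constant \<open>c\<close>.\<close>

definition neg_log_posterior ::
    "real \<Rightarrow> real^'n^'n \<Rightarrow> (real^'n \<Rightarrow> real^'n) \<Rightarrow> real^'n \<Rightarrow> real^'n^'n \<Rightarrow> real^'n \<Rightarrow> real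
      \<Rightarrow> real \<Rightarrow> real^'n \<Rightarrow> real" where
  "neg_log_posterior \<epsilon> A F m0 S0 y c \<tau> x =
     1/2 * (norm (forward_map A F \<tau> x - y))\<^sup>2 + \<epsilon>/2 * (weighted_norm S0 (x - m0))\<^sup>2 + c"

text \<open>The probability measure with Lebesgue density proportional to \<open>exp (- I x / \<epsilon>)\<close>.\<close>

definition posterior :: "real \<Rightarrow> (real^'n \<Rightarrow> real) \<Rightarrow> (real^'n) measure" where
  "posterior \<epsilon> I =
     density lborel (\<lambda>x. ennreal (exp (- I x / \<epsilon>) / (\<integral>z. exp (- I z / \<epsilon>) \<partial>lborel)))"

definition gaussian :: "real^'n \<Rightarrow> real^'n^'n \<Rightarrow> (real^'n) measure" where
  "gaussian m S =
     density lborel (\<lambda>x. ennreal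
       (exp (- (weighted_norm S (x - m))\<^sup>2 / 2) / sqrt ((2 * pi) ^ CARD('n) * det S)))"

definition tv_dist :: "(real^'n) measure \<Rightarrow> (real^'n) measure \<Rightarrow> real" where
  "tv_dist \<nu> \<mu> = (SUP B\<in>sets borel. \<bar>measure \<nu> B - measure \<mu> B\<bar>)"

end

theory Submission
  imports Defs
begin

text \<open>Write \<open>r\<close> for the \<open>\<Sigma>\<^sub>\<tau>\<close>-weighted distance to the minimiser. Along each ray from the minimiser the third
  derivative of \<open>I\<^sub>\<tau>\<close> is at most \<open>K = \<tau> V + \<tau>\<^sup>2 W \<le> 2 (\<tau> V + \<tau>\<^sup>2 W / 2)\<close>, hence \<open>I\<^sub>\<tau>\<close> differs from
  \<open>r\<^sup>2/2\<close> by at most \<open>K r\<^sup>3/6\<close>. Since \<open>F\<close> and its first two derivatives are bounded, the difference is also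
  \<open>O(\<tau>) r\<^sup>2\<close> for \<open>r \<ge> 1\<close>. For small \<open>\<tau>\<close> the two bounds give \<open>I\<^sub>\<tau> \<ge> \<delta> r\<^sup>2/2\<close> everywhere, for any
  prescribed \<open>\<delta> < 1\<close>. The total variation distance is then at most the third Gaussian moment
  \<open>(2 \<surd>2 / \<delta>\<^bsup>(d+3)/2\<^esup>) \<Gamma>(d/2 + 3/2) / \<Gamma>(d/2)\<close> times \<open>K \<surd>\<epsilon> / 6\<close>, and \<open>\<delta> = exp (- 2/(d+3))\<close> produces the
  factor \<open>e\<close>.\<close>

section \<open>Square roots of symmetric positive definite matrices\<close>

text \<open>The obstacle is the region far from the minimiser. The lower bound on \<open>I\<close>
  is needed at every point, both for integrability of \<open>exp (- I / \<epsilon>)\<close> and to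
  dominate the two exponentials whose difference is estimated, but the cubic bound gives nothing
  there, since r^3 outgrows r^2. The quadratic bound exploits that \<open>I\<close> would be exactly
  quadratic for F = 0: after subtracting the Taylor polynomial at the minimiser, only terms with a
  factor \<tau> and bounded values of F and its derivatives remain. They include constants and
  multiples of r, which r^2 absorbs only for r at least 1; hence both bounds are required. Distances
  are taken in the metric of the Hessian at the minimiser, so that the quadratic part is r^2/2 in
  every direction and the Gaussian integrals see the covariance only through its determinant. This
  is the reason for the matrix roots and the volumes of ellipsoids. The convergence hypotheses
  supply bounds on the data, the minimiser and the covariance for small positive \<tau>, so that one
  \<open>\<tau>1\<close> serves all of them.\<close>

lemma selfadjoint_eigenvector:
  fixes f :: "'a::euclidean_space \<Rightarrow> 'a"
  assumes f: "linear f" and sa: "\<And>x y. f x \<bullet> y = x \<bullet> f y"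
    and S: "subspace S" "f ` S \<subseteq> S" "S \<noteq> {0}"
  obtains e l where "e \<in> S" "norm e = 1" "f e = l *\<^sub>R e"
proof -
  obtain z where z: "z \<in> S" "z \<noteq> 0" using S subspace_0 by blast
  have "sgn z \<in> sphere 0 1 \<inter> S"
    using z S by (auto simp: norm_sgn sgn_div_norm subspace_scale)
  moreover have "compact (sphere 0 1 \<inter> S)"
    by (simp add: compact_Int_closed closed_subspace S)
  moreover have "continuous_on (sphere 0 1 \<inter> S) (\<lambda>x. x \<bullet> f x)"
    using f by (intro continuous_intros linear_continuous_on) (simp add: linear_conv_bounded_linear)
  ultimately obtain e where e: "e \<in> sphere 0 1 \<inter> S"
    and max: "\<And>x. x \<in> sphere 0 1 \<inter> S \<Longrightarrow> x \<bullet> f x \<le> e \<bullet> f e"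
    using continuous_attains_sup[of "sphere 0 1 \<inter> S" "\<lambda>x. x \<bullet> f x"] by blast
  define l where "l = e \<bullet> f e"
  have max2: "x \<bullet> f x \<le> l * (x \<bullet> x)" if "x \<in> S" for x
  proof (cases "x = 0")
    case False
    then have "sgn x \<in> sphere 0 1 \<inter> S"
      using that S by (auto simp: norm_sgn sgn_div_norm subspace_scale)
    from max[OF this] have "(x \<bullet> f x) / (x \<bullet> x) \<le> l"
      by (simp add: l_def sgn_div_norm linear_scale[OF f] divide_inverse power2_norm_eq_inner[symmetric]
          power2_eq_square mult_ac)
    then show ?thesis using False by (simp add: field_simps)
  qed (simp add: linear_0[OF f])
  \<comment> \<open>Residual of the eigenvalue equation at a maximiser of the Rayleigh quotient on
    the unit sphere of \<open>S\<close>. Moving \<open>e\<close> along \<open>w\<close> changes the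
    quotient's defect by \<open>2 * t * (w \<bullet> w)\<close> at first order and by
    \<open>t\<^sup>2 * D\<close> at second order, so \<open>w\<close> must vanish.\<close>
  define w where "w = f e - l *\<^sub>R e"
  have wS: "w \<in> S" using e S by (auto simp: w_def subspace_diff subspace_scale)
  have ee: "e \<bullet> e = 1" using e by (simp add: power2_norm_eq_inner[symmetric])
  define D where "D = l * (w \<bullet> w) - w \<bullet> f w"
  have key: "2 * t * (w \<bullet> w) \<le> t\<^sup>2 * D" for t
  proof -
    have "e + t *\<^sub>R w \<in> S" using e wS S by (auto simp: subspace_add subspace_scale)
    from max2[OF this] have *: "l + 2 * t * (f e \<bullet> w) + t\<^sup>2 * (w \<bullet> f w)
        \<le> l * (1 + 2 * t * (e \<bullet> w) + t\<^sup>2 * (w \<bullet> w))"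
      using sa[of e w] by (simp add: linear_add[OF f] linear_scale[OF f] inner_add_left inner_add_right ee
          l_def[symmetric] inner_commute power2_eq_square algebra_simps)
    have fw: "f e \<bullet> w = w \<bullet> w + l * (e \<bullet> w)"
      by (subst (2) w_def) (simp add: w_def inner_diff_left)
    show ?thesis using * unfolding fw D_def by (simp add: algebra_simps)
  qed
  have "w \<bullet> w = 0"
  proof (rule ccontr)
    assume "w \<bullet> w \<noteq> 0"
    then have p: "w \<bullet> w > 0" by simp
    have "2 * (w \<bullet> w) \<le> D" using key[of 1] by simp
    with p have D: "D > 0" by linarith
    \<comment> \<open>This step length maximises
      \<open>2 * t * (w \<bullet> w) - t\<^sup>2 * D\<close>, where \<open>key\<close> is violated
      most.\<close>
    have "2 * (w \<bullet> w / D) * (w \<bullet> w) \<le> (w \<bullet> w / D)\<^sup>2 * D" by (rule key)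
    also have "\<dots> = (w \<bullet> w / D) * (w \<bullet> w)" using D by (simp add: power2_eq_square)
    finally show False using mult_pos_pos[OF p p] D by (simp add: field_simps)
  qed
  then have "f e = l *\<^sub>R e" by (simp add: w_def)
  then show ?thesis using e that by auto
qed

text \<open>Self-adjointness makes the orthogonal complement of an eigenvector inside
  \<open>S\<close> invariant again, with smaller dimension. The claim speaks of invariant subspaces
  so that the induction can pass to this complement.\<close>

lemma selfadjoint_eigenbasis:
  fixes f :: "'a::euclidean_space \<Rightarrow> 'a"
  assumes f: "linear f" and sa: "\<And>x y. f x \<bullet> y = x \<bullet> f y"
    and S: "subspace S" "f ` S \<subseteq> S"
  shows "\<exists>B\<subseteq>S. pairwise orthogonal B \<and> (\<forall>b\<in>B. norm b = 1 \<and> (\<exists>l. f b = l *\<^sub>R b)) \<and> S \<subseteq> span B"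
  using S
proof (induction "dim S" arbitrary: S rule: less_induct)
  case less
  show ?case
  proof (cases "S = {0}")
    case True
    then show ?thesis by (intro exI[of _ "{}"]) auto
  next
    case False
    obtain e l where e: "e \<in> S" "norm e = 1" "f e = l *\<^sub>R e"
      using selfadjoint_eigenvector[OF f sa less.prems False] by blast
    have ee: "e \<bullet> e = 1" using e by (simp add: power2_norm_eq_inner[symmetric])
    define T where "T = {x \<in> S. x \<bullet> e = 0}"
    have T: "subspace T" using less.prems
      by (auto simp: T_def subspace_def inner_add_left)
    have fT: "f ` T \<subseteq> T" using less.prems e by (auto simp: T_def sa)
    have "T \<subseteq> S" "e \<notin> T" using ee by (auto simp: T_def)
    then have "T \<subset> S" using e by blast
    then have "dim T < dim S"
      using T less.prems by (metis dim_psubset span_eq_iff)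
    from less.hyps[OF this T fT] obtain B where B: "B \<subseteq> T" "pairwise orthogonal B"
      "\<forall>b\<in>B. norm b = 1 \<and> (\<exists>l. f b = l *\<^sub>R b)" "T \<subseteq> span B" by blast
    have "x \<in> span (insert e B)" if "x \<in> S" for x
    proof -
      have "x - (x \<bullet> e) *\<^sub>R e \<in> T" using that less.prems e ee
        by (auto simp: T_def subspace_diff subspace_scale inner_diff_left)
      then show ?thesis using B span_breakdown_eq[of x e B] by blast
    qed
    moreover have "pairwise orthogonal (insert e B)"
      using B by (auto simp: pairwise_insert orthogonal_def T_def inner_commute)
    ultimately show ?thesis
      using B e \<open>T \<subseteq> S\<close> by (intro exI[of _ "insert e B"]) auto
  qed
qed

lemma sym_pos_def_inner: "sym_pos_def S \<Longrightarrow> (S *v x) \<bullet> y = x \<bullet> (S *v y)"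
  unfolding sym_pos_def_def by (metis dot_lmul_matrix vector_transpose_matrix)

lemma sym_pos_def_eigenbasis:
  assumes "sym_pos_def (S :: real^'n^'n)"
  obtains B :: "(real^'n) set" and l where "finite B" "pairwise orthogonal B" "\<And>b. b \<in> B \<Longrightarrow> norm b = 1"
    "\<And>b. b \<in> B \<Longrightarrow> S *v b = l b *\<^sub>R b" "\<And>b. b \<in> B \<Longrightarrow> l b > 0" "span B = UNIV"
proof -
  obtain B where B0: "pairwise orthogonal B" "\<forall>b\<in>B. norm b = 1 \<and> (\<exists>l. S *v b = l *\<^sub>R b)" "UNIV \<subseteq> span B"
    using selfadjoint_eigenbasis[of "(*v) S" UNIV] sym_pos_def_inner[OF assms] by auto
  then have B: "pairwise orthogonal B" "\<And>b. b \<in> B \<Longrightarrow> norm b = 1"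
     "\<And>b. b \<in> B \<Longrightarrow> \<exists>l. S *v b = l *\<^sub>R b" "span B = UNIV"
    by auto
  obtain l where l: "\<And>b. b \<in> B \<Longrightarrow> S *v b = l b *\<^sub>R b" using B(3) by metis
  have "0 \<notin> B" using B(2) by force
  then have "finite B"
    using B(1) pairwise_orthogonal_independent independent_imp_finite by blast
  moreover have "l b > 0" if "b \<in> B" for b
  proof -
    have "b \<noteq> 0" using that \<open>0 \<notin> B\<close> by blast
    then have "0 < b \<bullet> (S *v b)" using assms by (simp add: sym_pos_def_def)
    then show ?thesis using B(2)[OF that] l[OF that] by (simp add: power2_norm_eq_inner[symmetric])
  qed
  ultimately show ?thesis using B l that by blast
qed

text \<open>The root is diagonal in the eigenbasis of \<open>S\<close>: \<open>g\<close> multiplies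
  each coefficient by the square root of the eigenvalue. Symmetry and positivity are then visible in
  the sum for \<open>x \<bullet> g y\<close>.\<close>

lemma sym_pos_def_sqrt_exists:
  assumes "sym_pos_def (S :: real^'n^'n)"
  shows "\<exists>R. sym_pos_def R \<and> R ** R = S"
proof -
  obtain B :: "(real^'n) set" and l where B: "finite B" "pairwise orthogonal B" "\<And>b. b \<in> B \<Longrightarrow> norm b = 1"
    "\<And>b. b \<in> B \<Longrightarrow> S *v b = l b *\<^sub>R b" "\<And>b. b \<in> B \<Longrightarrow> l b > 0" "span B = UNIV"
    using sym_pos_def_eigenbasis[OF assms] by blast
  define g where "g x = (\<Sum>b\<in>B. (sqrt (l b) * (x \<bullet> b)) *\<^sub>R b)" for x
  have g: "linear g" unfolding g_def
    by (intro linearI) (simp_all add: inner_add_left algebra_simps sum.distrib scaleR_sum_right)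
  have mg: "matrix g *v x = g x" for x by (simp add: matrix_works g)
  have gb: "g b = sqrt (l b) *\<^sub>R b" if "b \<in> B" for b
  proof -
    have "b \<bullet> b' = (if b' = b then 1 else 0)" if "b' \<in> B" for b'
      using B(2,3) \<open>b \<in> B\<close> that by (auto simp: pairwise_def orthogonal_def power2_norm_eq_inner[symmetric])
    then have "g b = (\<Sum>b'\<in>B. if b' = b then sqrt (l b) *\<^sub>R b else 0)"
      unfolding g_def by (intro sum.cong) auto
    then show ?thesis using B(1) that by simp
  qed
  have ginner: "x \<bullet> g y = (\<Sum>b\<in>B. sqrt (l b) * (x \<bullet> b) * (y \<bullet> b))" for x y
    by (simp add: g_def inner_sum_right mult_ac)
  have "transpose (matrix g) = matrix g"
  proof -
    have "(transpose (matrix g) *v y) \<bullet> x = (matrix g *v y) \<bullet> x" for x y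
    proof -
      have "(transpose (matrix g) *v y) \<bullet> x = y \<bullet> g x"
        by (metis mg dot_lmul_matrix vector_transpose_matrix transpose_transpose)
      also have "\<dots> = x \<bullet> g y" by (simp add: ginner mult_ac)
      finally show ?thesis by (simp add: mg inner_commute)
    qed
    then have "(transpose (matrix g) *v y) = (matrix g *v y)" for y
      by (metis vector_eq_rdot)
    then show ?thesis by (simp add: matrix_eq)
  qed
  moreover have "0 < x \<bullet> (matrix g *v x)" if "x \<noteq> 0" for x
  proof -
    have "(\<Sum>b\<in>B. (x \<bullet> b) *\<^sub>R b) = x"
      using B by (intro orthonormal_basis_expand) auto
    moreover have "(\<Sum>b\<in>B. (x \<bullet> b) *\<^sub>R b) = 0" if "\<forall>b\<in>B. x \<bullet> b = 0"
      using that by (intro sum.neutral) auto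
    ultimately obtain b where b: "b \<in> B" "x \<bullet> b \<noteq> 0"
      using \<open>x \<noteq> 0\<close> by metis
    have "0 < (\<Sum>b\<in>B. sqrt (l b) * (x \<bullet> b) * (x \<bullet> b))"
    proof (rule sum_pos2[OF B(1) b(1)])
      show "0 < sqrt (l b) * (x \<bullet> b) * (x \<bullet> b)"
        using B(5)[OF b(1)] b(2) not_real_square_gt_zero[of "x \<bullet> b"]
          mult_pos_pos[of "sqrt (l b)" "(x \<bullet> b) * (x \<bullet> b)"]
        unfolding mult.assoc real_sqrt_gt_0_iff by blast
      show "0 \<le> sqrt (l i) * (x \<bullet> i) * (x \<bullet> i)" if "i \<in> B" for i
        using B(5)[OF that] by (simp add: mult.assoc)
    qed
    then show ?thesis by (simp add: mg ginner)
  qed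
  moreover have "matrix g ** matrix g = S"
  proof -
    have "(matrix g ** matrix g) *v x = S *v x" for x
    proof (rule linear_eq_on[of "(*v) (matrix g ** matrix g)" "(*v) S" x B])
      show "matrix g ** matrix g *v b = S *v b" if "b \<in> B" for b
        using B(4)[OF that] B(5)[OF that]
        by (simp add: matrix_vector_mul_assoc[symmetric] mg gb[OF that] linear_scale[OF g])
    qed (use B in auto)
    then show ?thesis by (simp add: matrix_eq)
  qed
  ultimately show ?thesis unfolding sym_pos_def_def by blast
qed

text \<open>Factor \<open>R ** R - l\<close> as (R + sqrt l)(R - sqrt l): the vector
  \<open>w\<close> is annihilated by the first factor, so it would be an eigenvector of
  \<open>R\<close> for a negative eigenvalue, which positivity excludes unless \<open>w\<close> is
  zero.\<close>

lemma sym_pos_def_sqrt_eigenvector: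
  assumes R: "sym_pos_def R" "(R ** R) *v x = l *\<^sub>R x" "l > 0"
  shows "R *v x = sqrt l *\<^sub>R x"
proof -
  define w where "w = R *v x - sqrt l *\<^sub>R x"
  have "R *v w = - sqrt l *\<^sub>R w"
    using R(2,3) by (simp add: w_def matrix_vector_mult_diff_distrib matrix_vector_mult_scaleR
        matrix_vector_mul_assoc algebra_simps)
  then have "w \<bullet> (R *v w) \<le> 0" using R(3) by simp
  then have "w = 0" using R(1) unfolding sym_pos_def_def by (meson not_less)
  then show ?thesis by (simp add: w_def)
qed

text \<open>\<open>matrix_sqrt\<close> is a definite description, so it is usable only once the root
  is known to be unique. Two roots agree on every eigenvector of \<open>S\<close>, hence on a
  spanning set.\<close>

lemma matrix_sqrt_works:
  assumes "sym_pos_def S"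
  shows "sym_pos_def (matrix_sqrt S)" "matrix_sqrt S ** matrix_sqrt S = S"
proof -
  have "R = R'" if R: "sym_pos_def R" "R ** R = S" and R': "sym_pos_def R'" "R' ** R' = S" for R R'
  proof -
    obtain B :: "(real^'a) set" and l where B: "finite B" "pairwise orthogonal B" "\<And>b. b \<in> B \<Longrightarrow> norm b = 1"
      "\<And>b. b \<in> B \<Longrightarrow> S *v b = l b *\<^sub>R b" "\<And>b. b \<in> B \<Longrightarrow> l b > 0" "span B = UNIV"
      using sym_pos_def_eigenbasis[OF assms] by blast
    have "R *v x = R' *v x" for x
    proof (rule linear_eq_on[of "(*v) R" "(*v) R'" x B])
      show "R *v b = R' *v b" if "b \<in> B" for b
        using B(4)[OF that] B(5)[OF that] R R' sym_pos_def_sqrt_eigenvector[of R b "l b"]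
          sym_pos_def_sqrt_eigenvector[of R' b "l b"] by simp
    qed (use B in auto)
    then show ?thesis by (simp add: matrix_eq)
  qed
  then have ex1: "\<exists>!R. sym_pos_def R \<and> R ** R = S"
    using sym_pos_def_sqrt_exists[OF assms] by blast
  then show "sym_pos_def (matrix_sqrt S)" "matrix_sqrt S ** matrix_sqrt S = S"
    unfolding matrix_sqrt_def using theI'[OF ex1] by auto
qed

section \<open>Inverses, and the weighted norm as a quadratic form\<close>

lemma sym_pos_def_invertible: "sym_pos_def S \<Longrightarrow> invertible S"
  unfolding invertible_left_inverse matrix_left_invertible_ker sym_pos_def_def
  by (metis inner_zero_right less_irrefl)

lemma matrix_inv_mult:
  assumes "invertible A" shows "A ** matrix_inv A = mat 1" "matrix_inv A ** A = mat 1"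
  using someI_ex[of "\<lambda>B. A ** B = mat 1 \<and> B ** A = mat 1"] assms
  unfolding matrix_inv_def invertible_def by auto

lemma sym_pos_def_mult_inv:
  assumes "sym_pos_def S"
  shows "S *v (matrix_inv S *v x) = x" "matrix_inv S *v (S *v x) = x"
  using sym_pos_def_invertible[OF assms]
  by (simp_all add: matrix_vector_mul_assoc matrix_inv_mult)

lemma matrix_inv_eqI:
  assumes "A ** B = mat 1" shows "matrix_inv A = (B :: real^'n^'n)"
  using assms by (metis invertible_def matrix_inv_mult(1) matrix_left_right_inverse matrix_mul_assoc
      matrix_mul_lid matrix_mul_rid)

lemma sym_pos_def_matrix_inv:
  assumes "sym_pos_def S" shows "sym_pos_def (matrix_inv S)"
  unfolding sym_pos_def_def
proof (intro conjI allI impI)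
  have "transpose (matrix_inv S) = matrix_inv (transpose S)"
    using matrix_inv_eqI[of "transpose S" "transpose (matrix_inv S)"] sym_pos_def_invertible[OF assms]
    by (metis matrix_inv_mult(1) matrix_left_right_inverse matrix_transpose_mul transpose_mat)
  then show "transpose (matrix_inv S) = matrix_inv S"
    using assms by (simp add: sym_pos_def_def)
  fix x :: "real^'a" assume "x \<noteq> 0"
  then have "matrix_inv S *v x \<noteq> 0"
    by (metis assms matrix_vector_mult_0_right sym_pos_def_mult_inv(1))
  then have "0 < (matrix_inv S *v x) \<bullet> (S *v (matrix_inv S *v x))"
    using assms by (simp add: sym_pos_def_def)
  then show "0 < x \<bullet> (matrix_inv S *v x)"
    by (simp add: sym_pos_def_mult_inv[OF assms] inner_commute)
qed

lemma matrix_inv_matrix_inv: "invertible S \<Longrightarrow> matrix_inv (matrix_inv S) = (S :: real^'n^'n)"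
  by (rule matrix_inv_eqI) (simp add: matrix_inv_mult)

text \<open>The inverse of the root squares to the inverse of \<open>S\<close>. When
  \<open>S\<close> is an inverse Hessian, half of this square is the second-order Taylor term, which
  ties the covariance to \<open>I\<close>.\<close>

lemma weighted_norm_sq:
  assumes "sym_pos_def S"
  shows "(weighted_norm S x)\<^sup>2 = x \<bullet> (matrix_inv S *v x)"
proof -
  let ?R = "matrix_sqrt S"
  note R = matrix_sqrt_works[OF assms]
  have iR: "sym_pos_def (matrix_inv ?R)" by (rule sym_pos_def_matrix_inv[OF R(1)])
  have "S ** (matrix_inv ?R ** matrix_inv ?R) = ?R ** (?R ** matrix_inv ?R) ** matrix_inv ?R"
    by (simp add: matrix_mul_assoc R(2))
  also have "\<dots> = mat 1"
    using sym_pos_def_invertible[OF R(1)] by (simp add: matrix_inv_mult)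
  finally have "matrix_inv S = matrix_inv ?R ** matrix_inv ?R" by (rule matrix_inv_eqI)
  then show ?thesis
    by (simp add: weighted_norm_def power2_norm_eq_inner sym_pos_def_inner[OF iR] matrix_vector_mul_assoc)
qed

section \<open>Lebesgue measure of ellipsoids\<close>

declare transpose_matrix_vector [simp del]

text \<open>The library's \<open>measure_linear_image\<close> needs a well-ordered index type, so the volume of an ellipsoid
  is obtained here from a diagonalization and the orthogonal invariance of Lebesgue measure.\<close>

lemma sym_pos_def_diagonalization:
  fixes R :: "real^'n^'n"
  assumes "sym_pos_def R"
  obtains Q :: "real^'n^'n" and d :: "'n \<Rightarrow> real" where "orthogonal_matrix Q" "\<And>i. d i > 0"
    "R = Q ** (\<chi> i j. if i = j then d i else 0) ** transpose Q"
proof -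
  obtain B :: "(real^'n) set" and l where B: "finite B" "pairwise orthogonal B" "\<And>b. b \<in> B \<Longrightarrow> norm b = 1"
    "\<And>b. b \<in> B \<Longrightarrow> R *v b = l b *\<^sub>R b" "\<And>b. b \<in> B \<Longrightarrow> l b > 0" "span B = UNIV"
    using sym_pos_def_eigenbasis[OF assms] by blast
  have "0 \<notin> B" using B(3) by force
  then have "independent B" using B(2) pairwise_orthogonal_independent by blast
  \<comment> \<open>The count lets the basis be enumerated by the index type; the enumeration
    \<open>\<beta>\<close> supplies the columns of \<open>Q\<close>.\<close>
  then have "card B = CARD('n)"
    using B(6) by (metis dim_UNIV dim_span dim_eq_card_independent DIM_cart DIM_real mult.right_neutral)
  then obtain \<beta> where \<beta>: "bij_betw \<beta> (UNIV :: 'n set) B"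
    using B(1) by (metis finite_same_card_bij finite)
  have \<beta>B: "\<beta> i \<in> B" for i using \<beta> by (auto simp: bij_betw_def)
  define Q :: "real^'n^'n" where "Q = (\<chi> i j. \<beta> j $ i)"
  let ?D = "(\<chi> i j. if i = j then l (\<beta> i) else 0) :: real^'n^'n"
  have col: "column j Q = \<beta> j" for j by (simp add: Q_def column_def vec_eq_iff)
  have "orthogonal (\<beta> i) (\<beta> j)" if "i \<noteq> j" for i j
    using B(2) \<beta> \<beta>B that unfolding pairwise_def bij_betw_def inj_on_def by blast
  then have Q: "orthogonal_matrix Q"
    unfolding orthogonal_matrix_orthonormal_columns col using B(3) \<beta>B by auto
  have "R ** Q = Q ** ?D"
  proof -
    have "(R ** Q) $ i $ j = (Q ** ?D) $ i $ j" for i j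
    proof -
      have "(R ** Q) $ i $ j = (R *v \<beta> j) $ i"
        by (simp add: matrix_matrix_mult_def matrix_vector_mult_def Q_def)
      also have "\<dots> = l (\<beta> j) * \<beta> j $ i" by (simp add: B(4)[OF \<beta>B])
      also have "\<dots> = (Q ** ?D) $ i $ j"
        by (simp add: matrix_matrix_mult_def Q_def if_distrib[of "\<lambda>x. _ * x"] sum.delta cong: if_cong)
      finally show ?thesis .
    qed
    then show ?thesis by (simp add: vec_eq_iff)
  qed
  then have "R = Q ** ?D ** transpose Q"
    using Q by (metis matrix_mul_assoc matrix_mul_rid orthogonal_matrix_def)
  then show ?thesis using that[OF Q, of "\<lambda>i. l (\<beta> i)"] B(5)[OF \<beta>B] by blast
qed

text \<open>The argument for the uniqueness of Haar measure, by Tonelli; a ball serves as the symmetric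
  reference set.\<close>

lemma lborel_translation_invariant_unique:
  fixes \<mu> :: "'a::euclidean_space measure"
  assumes "sigma_finite_measure \<mu>" and [simp, measurable_cong]: "sets \<mu> = sets borel"
    and inv: "\<And>t. distr \<mu> borel (\<lambda>x. t + x) = \<mu>"
    and ball: "emeasure \<mu> (cball 0 1) = emeasure lborel (cball (0::'a) 1)"
  shows "\<mu> = lborel"
proof (rule measure_eqI)
  interpret M: sigma_finite_measure \<mu> by fact
  interpret pair_sigma_finite \<mu> "lborel :: 'a measure" by standard
  let ?K = "cball 0 1 :: 'a set"
  have tr: "(\<integral>\<^sup>+y. f (t + y) \<partial>\<mu>) = (\<integral>\<^sup>+y. f y \<partial>\<mu>)" if [measurable]: "f \<in> borel_measurable borel" for f t
    by (subst (2) inv[of t, symmetric]) (simp add: nn_integral_distr)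
  have trl: "(\<integral>\<^sup>+y. f (t + y) \<partial>lborel) = (\<integral>\<^sup>+y. f y \<partial>lborel)" if [measurable]: "f \<in> borel_measurable borel"
    for f and t :: 'a
    by (subst (2) lborel_distr_plus[of t, symmetric]) (simp add: nn_integral_distr)
  have K [measurable]: "?K \<in> sets borel" by (simp add: borel_closed)
  have [measurable]: "(\<lambda>z. indicator ?K (snd z) * indicator B (snd z + fst z) :: ennreal) \<in> borel_measurable (\<mu> \<Otimes>\<^sub>M lborel)"
    "(\<lambda>z. indicator ?K (snd z - fst z) * indicator B (snd z) :: ennreal) \<in> borel_measurable (\<mu> \<Otimes>\<^sub>M lborel)"
    if [measurable]: "B \<in> sets borel" for B
    by measurable
  have Kp: "emeasure lborel ?K \<noteq> 0" "emeasure lborel ?K \<noteq> \<infinity>"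
    using unit_ball_vol_pos[of "real DIM('a)"] by (simp_all add: emeasure_cball del: unit_ball_vol_pos)
  fix B assume "B \<in> sets \<mu>"
  then have [measurable]: "B \<in> sets borel" by simp
  have "emeasure lborel ?K * emeasure \<mu> B = (\<integral>\<^sup>+x. indicator ?K x * (\<integral>\<^sup>+y. indicator B (x + y) \<partial>\<mu>) \<partial>lborel)"
    by (subst tr, simp, subst nn_integral_multc) auto
  also have "\<dots> = (\<integral>\<^sup>+x. (\<integral>\<^sup>+y. indicator ?K x * indicator B (x + y) \<partial>\<mu>) \<partial>lborel)"
    by (subst nn_integral_cmult) auto
  also have "\<dots> = (\<integral>\<^sup>+y. (\<integral>\<^sup>+x. indicator ?K x * indicator B (x + y) \<partial>lborel) \<partial>\<mu>)"
    by (rule Fubini') (simp add: split_beta')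
  \<comment> \<open>Lebesgue measure absorbs the shift by \<open>y\<close>, which thereby moves from
    \<open>B\<close> to the ball. The mirror step, with \<open>\<mu>\<close> absorbing a shift by
    \<open>x\<close>, separates the two sets.\<close>
  also have "\<dots> = (\<integral>\<^sup>+y. (\<integral>\<^sup>+x. indicator ?K (x - y) * indicator B x \<partial>lborel) \<partial>\<mu>)"
  proof (rule nn_integral_cong)
    fix y
    show "(\<integral>\<^sup>+x. indicator ?K x * indicator B (x + y) \<partial>lborel) =
        (\<integral>\<^sup>+x. indicator ?K (x - y) * indicator B x \<partial>lborel)"
      using trl[of "\<lambda>x. indicator ?K (x - y) * indicator B x" y] by (simp add: add.commute)
  qed
  also have "\<dots> = (\<integral>\<^sup>+x. (\<integral>\<^sup>+y. indicator ?K (x - y) * indicator B x \<partial>\<mu>) \<partial>lborel)"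
    by (rule Fubini'[symmetric]) (simp add: split_beta')
  also have "\<dots> = (\<integral>\<^sup>+x. emeasure \<mu> ?K * indicator B x \<partial>lborel)"
  proof (rule nn_integral_cong)
    fix x
    have "(\<integral>\<^sup>+y. indicator ?K (x - y) * indicator B x \<partial>\<mu>) = (\<integral>\<^sup>+y. indicator ?K (x - y) \<partial>\<mu>) * indicator B x"
      by (subst nn_integral_multc) auto
    also have "(\<integral>\<^sup>+y. indicator ?K (x - y) \<partial>\<mu>) = (\<integral>\<^sup>+y. indicator ?K (x - (x + y)) \<partial>\<mu>)"
      by (rule tr[symmetric]) measurable
    \<comment> \<open>\<open>x - (x + y)\<close> is \<open>- y\<close>; the symmetry of the ball
      removes the reflection.\<close>
    also have "\<dots> = (\<integral>\<^sup>+y. indicator ?K y \<partial>\<mu>)"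
      by (intro nn_integral_cong) (auto split: split_indicator)
    finally show "(\<integral>\<^sup>+y. indicator ?K (x - y) * indicator B x \<partial>\<mu>) = emeasure \<mu> ?K * indicator B x" by simp
  qed
  also have "\<dots> = emeasure lborel ?K * emeasure lborel B"
    by (subst nn_integral_cmult) (auto simp: ball)
  finally show "emeasure \<mu> B = emeasure lborel B"
    using Kp by (simp add: ennreal_mult_cancel_left)
qed simp

text \<open>With \<open>g\<close> the inverse of \<open>f\<close>, \<open>t + f x\<close> equals
  \<open>f (g t + x)\<close>, so the image measure inherits translation invariance. Since
  \<open>f\<close> preserves the norm, centred balls keep their volume, which gives both the
  normalisation and sigma-finiteness.\<close>

lemma lborel_orthogonal_transformation:
  fixes f :: "'a::euclidean_space \<Rightarrow> 'a"
  assumes "orthogonal_transformation f"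
  shows "distr lborel borel f = lborel"
proof (rule lborel_translation_invariant_unique)
  have lin: "linear f" using assms by (simp add: orthogonal_transformation_def)
  then have [measurable]: "f \<in> borel_measurable borel"
    by (intro borel_measurable_continuous_onI linear_continuous_on) (simp add: linear_conv_bounded_linear)
  obtain g where g: "orthogonal_transformation g" "\<And>x. f (g x) = x" "\<And>x. g (f x) = x"
    using orthogonal_transformation_inv[OF assms] orthogonal_transformation_bij[OF assms]
    by (metis bij_is_inj bij_is_surj inv_f_f surj_f_inv_f)
  have [measurable]: "g \<in> borel_measurable borel" using g(1)
    by (intro borel_measurable_continuous_onI linear_continuous_on)
       (simp add: linear_conv_bounded_linear[symmetric] orthogonal_transformation_def)
  have nf: "norm (f x) = norm x" for x using assms by (simp add: orthogonal_transformation)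
  have vim: "f -` cball 0 r = cball 0 r" for r by (auto simp: nf)
  show "emeasure (distr lborel borel f) (cball 0 1) = emeasure lborel (cball (0::'a) 1)"
    by (subst emeasure_distr) (auto simp: vim)
  show "distr (distr lborel borel f) borel ((+) t) = distr lborel borel f" for t
  proof -
    have "distr (distr lborel borel f) borel ((+) t) = distr lborel borel (\<lambda>x. t + f x)"
      by (subst distr_distr) (auto simp: comp_def)
    also have "(\<lambda>x. t + f x) = (\<lambda>x. f (g t + x))" by (simp add: linear_add[OF lin] g)
    also have "distr lborel borel (\<lambda>x. f (g t + x)) = distr (distr lborel borel ((+) (g t))) borel f"
      by (subst distr_distr) (auto simp: comp_def)
    finally show ?thesis by (simp add: lborel_distr_plus)
  qed
  show "sigma_finite_measure (distr lborel borel f)"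
  proof
    show "\<exists>A. countable A \<and> A \<subseteq> sets (distr lborel borel f) \<and> \<Union>A = space (distr lborel borel f) \<and>
        (\<forall>a\<in>A. emeasure (distr lborel borel f) a \<noteq> \<infinity>)"
    proof (intro exI[of _ "range (\<lambda>n. cball 0 (real n))"] conjI ballI)
      show "\<Union> (range (\<lambda>n. cball (0::'a) (real n))) = space (distr lborel borel f)"
        by (auto intro: real_arch_simple)
      fix a assume "a \<in> range (\<lambda>n. cball (0::'a) (real n))"
      then obtain n where a: "a = cball 0 (real n)" by auto
      have "emeasure (distr lborel borel f) a = emeasure lborel (cball 0 (real n) :: 'a set)"
        unfolding a by (subst emeasure_distr) (auto simp: vim)
      then show "emeasure (distr lborel borel f) a \<noteq> \<infinity>" by (simp add: emeasure_cball)
    qed auto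
  qed
qed simp

lemma emeasure_orthogonal_image:
  fixes Q :: "real^'n^'n"
  assumes "orthogonal_matrix Q" "X \<in> sets borel"
  shows "emeasure lborel ((*v) Q ` X) = emeasure lborel X"
proof -
  have QT: "orthogonal_transformation ((*v) (transpose Q))"
    using assms(1) by (simp add: orthogonal_transformation_matrix orthogonal_matrix_transpose)
  have inv: "transpose Q *v (Q *v x) = x" "Q *v (transpose Q *v x) = x" for x
    using assms(1) by (simp_all add: matrix_vector_mul_assoc orthogonal_matrix_def)
  have [measurable]: "(*v) (transpose Q) \<in> borel_measurable borel"
    by (intro borel_measurable_continuous_onI linear_continuous_on) simp
  have "(*v) Q ` X = (*v) (transpose Q) -` X"
  proof (intro set_eqI iffI)
    fix x assume "x \<in> (*v) (transpose Q) -` X"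
    then show "x \<in> (*v) Q ` X" by (intro image_eqI[of _ _ "transpose Q *v x"]) (auto simp: inv)
  qed (auto simp: inv)
  then have "emeasure lborel ((*v) Q ` X) = emeasure (distr lborel borel ((*v) (transpose Q))) X"
    using assms(2) by (subst emeasure_distr) auto
  then show ?thesis by (simp add: lborel_orthogonal_transformation[OF QT])
qed

text \<open>The matrix scales each coordinate separately, and \<open>lborel_affine_euclidean\<close>
  applies with scaling vector \<open>?d\<close> and translation 0. Compactness of \<open>X\<close>
  passes to its image and makes it Borel.\<close>

lemma emeasure_diagonal_image:
  fixes d :: "'n::finite \<Rightarrow> real"
  assumes d: "\<And>i. d i > 0" and X: "compact X"
  shows "emeasure lborel ((*v) (\<chi> i j. if i = j then d i else 0) ` X) = ennreal (\<Prod>i\<in>UNIV. d i) * emeasure lborel X"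
proof -
  let ?D = "(\<chi> i j. if i = j then d i else 0) :: real^'n^'n"
  let ?d = "(\<chi> i. d i) :: real^'n"
  have Basis: "Basis = (\<lambda>i::'n. axis i (1::real)) ` UNIV" by (auto simp: Basis_vec_def)
  have injB: "inj (\<lambda>i::'n. axis i (1::real))" by (auto simp: inj_on_def axis_eq_axis)
  have D: "?D *v x = (\<chi> i. d i * x $ i)" for x
    by (simp add: matrix_vector_mult_def vec_eq_iff mult_delta_left)
  have T: "(\<lambda>x. ?D *v x) = (\<lambda>x. 0 + (\<Sum>j\<in>Basis. ((?d \<bullet> j) * (x \<bullet> j)) *\<^sub>R j))"
  proof
    fix x
    have "(0 + (\<Sum>j\<in>Basis. ((?d \<bullet> j) * (x \<bullet> j)) *\<^sub>R j)) \<bullet> b = (?D *v x) \<bullet> b" if b: "b \<in> Basis" for b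
    proof -
      have "(0 + (\<Sum>j\<in>Basis. ((?d \<bullet> j) * (x \<bullet> j)) *\<^sub>R j)) \<bullet> b = (?d \<bullet> b) * (x \<bullet> b)"
        using b by (simp add: inner_sum_left_Basis)
      also have "\<dots> = (?D *v x) \<bullet> b" using b by (auto simp: Basis inner_axis D)
      finally show ?thesis .
    qed
    then show "?D *v x = 0 + (\<Sum>j\<in>Basis. ((?d \<bullet> j) * (x \<bullet> j)) *\<^sub>R j)"
      by (rule euclidean_eqI[symmetric])
  qed
  have prod: "(\<Prod>j\<in>Basis. \<bar>?d \<bullet> j\<bar>) = (\<Prod>i\<in>UNIV. d i)"
    unfolding Basis prod.reindex[OF injB] comp_def by (simp add: inner_axis abs_of_pos d)
  have "lborel = density (distr lborel borel ((*v) ?D)) (\<lambda>_. (\<Prod>j\<in>Basis. \<bar>?d \<bullet> j\<bar>))"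
    unfolding T
  proof (rule lborel_affine_euclidean)
    fix j :: "real^'n" assume "j \<in> Basis"
    then obtain i where "j = axis i 1" unfolding Basis by blast
    then show "?d \<bullet> j \<noteq> 0" using d[of i] by (simp add: inner_axis)
  qed
  then have L: "lborel = density (distr lborel borel ((*v) ?D)) (\<lambda>_. ennreal (\<Prod>i\<in>UNIV. d i))"
    unfolding prod .
  have cont: "continuous_on A ((*v) ?D)" for A by (intro linear_continuous_on) simp
  have [measurable]: "(*v) ?D \<in> borel_measurable borel" using cont by (rule borel_measurable_continuous_onI)
  have im [measurable]: "(*v) ?D ` X \<in> sets borel"
    using X cont by (intro borel_compact compact_continuous_image)
  have "inj ((*v) ?D)"
  proof (rule injI)
    fix x y assume "?D *v x = ?D *v y"
    then have "d i * x $ i = d i * y $ i" for i by (simp add: D vec_eq_iff)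
    then show "x = y" using less_imp_neq[OF d] by (simp add: vec_eq_iff)
  qed
  then have vim: "(*v) ?D -` ((*v) ?D ` X) = X" by (rule inj_vimage_image_eq)
  have "emeasure lborel ((*v) ?D ` X) = emeasure (density (distr lborel borel ((*v) ?D)) (\<lambda>_. ennreal (\<Prod>i\<in>UNIV. d i))) ((*v) ?D ` X)"
    by (subst L) simp
  also have "\<dots> = ennreal (\<Prod>i\<in>UNIV. d i) * emeasure (distr lborel borel ((*v) ?D)) ((*v) ?D ` X)"
    by (subst emeasure_density) (auto simp: nn_integral_cmult)
  also have "emeasure (distr lborel borel ((*v) ?D)) ((*v) ?D ` X) = emeasure lborel X"
    by (subst emeasure_distr) (auto simp: vim)
  finally show ?thesis .
qed

text \<open>In the diagonalization the inner rotation maps the ball to itself, the diagonal factor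
  contributes the product of the eigenvalues, and the outer rotation preserves volume. That product
  is \<open>det R\<close>.\<close>

lemma emeasure_sym_pos_def_image_cball:
  fixes R :: "real^'n^'n"
  assumes "sym_pos_def R"
  shows "emeasure lborel ((*v) R ` cball 0 r) = ennreal (det R) * emeasure lborel (cball (0::real^'n) r)"
proof -
  obtain Q :: "real^'n^'n" and d :: "'n \<Rightarrow> real" where Q: "orthogonal_matrix Q" and d: "\<And>i. d i > 0"
    and R: "R = Q ** (\<chi> i j. if i = j then d i else 0) ** transpose Q"
    by (rule sym_pos_def_diagonalization[OF assms]) (rule that)
  let ?D = "(\<chi> i j. if i = j then d i else 0) :: real^'n^'n"
  have QT: "orthogonal_transformation ((*v) (transpose Q))"
    using Q by (simp add: orthogonal_transformation_matrix orthogonal_matrix_transpose)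
  have inv: "transpose Q ** Q = mat 1" "Q ** transpose Q = mat 1"
    using Q by (simp_all add: orthogonal_matrix_def)
  have "(*v) (transpose Q) ` cball 0 r = cball 0 r"
    using image_orthogonal_transformation_cball[OF QT, of 0 r] by simp
  moreover have "R *v x = Q *v (?D *v (transpose Q *v x))" for x
    by (simp add: R matrix_vector_mul_assoc matrix_mul_assoc)
  then have "(*v) R ` cball 0 r = (*v) Q ` ((*v) ?D ` ((*v) (transpose Q) ` cball 0 r))"
    by (simp add: image_image)
  ultimately have im: "(*v) R ` cball 0 r = (*v) Q ` ((*v) ?D ` cball 0 r)" by simp
  have comp: "compact ((*v) ?D ` cball 0 r)"
    by (intro compact_continuous_image linear_continuous_on) auto
  have "det R = det (transpose Q ** Q) * det ?D"
    unfolding R by (simp add: det_mul mult_ac)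
  also have "\<dots> = (\<Prod>i\<in>UNIV. d i)"
    by (simp add: inv det_diagonal)
  finally show ?thesis
    unfolding im using emeasure_orthogonal_image[OF Q borel_compact[OF comp]]
      emeasure_diagonal_image[OF d, of "cball 0 r"] by simp
qed

lemma sym_pos_def_det_pos:
  assumes "sym_pos_def S" shows "det S > 0"
proof -
  have "det S = det (matrix_sqrt S) * det (matrix_sqrt S)" using matrix_sqrt_works(2)[OF assms] by (metis det_mul)
  moreover have "det S \<noteq> 0" using sym_pos_def_invertible[OF assms] by (simp add: invertible_det_nz)
  ultimately show ?thesis by (metis not_real_square_gt_zero mult_eq_0_iff)
qed

text \<open>The sublevel set is a ball of radius \<open>sqrt (2 * a)\<close> pushed through
  \<open>matrix_sqrt S\<close> and translated by \<open>m\<close>, and the root has determinant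
  \<open>sqrt (det S)\<close>. Read as a function of \<open>a\<close>, the volume is the
  distribution function of half the squared distance.\<close>

lemma weighted_norm_ellipsoid:
  fixes S :: "real^'n^'n"
  assumes S: "sym_pos_def S" and a: "a \<ge> 0"
  shows "emeasure lborel {x. (weighted_norm S (x - m))\<^sup>2 / 2 \<le> a} =
    ennreal (sqrt (det S) * unit_ball_vol (real CARD('n)) * (2 * a) powr (real CARD('n) / 2))"
proof -
  let ?R = "matrix_sqrt S"
  note R = matrix_sqrt_works(1)[OF S]
  have eq: "{x. (weighted_norm S (x - m))\<^sup>2 / 2 \<le> a} = (+) m ` ((*v) ?R ` cball 0 (sqrt (2 * a)))"
  proof (intro set_eqI iffI)
    fix x assume "x \<in> {x. (weighted_norm S (x - m))\<^sup>2 / 2 \<le> a}"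
    then have "weighted_norm S (x - m) \<le> sqrt (2 * a)"
      by (intro real_le_rsqrt) simp
    then show "x \<in> (+) m ` ((*v) ?R ` cball 0 (sqrt (2 * a)))"
      unfolding weighted_norm_def image_image
      by (intro image_eqI[of _ _ "matrix_inv ?R *v (x - m)"])
         (auto simp: sym_pos_def_mult_inv[OF R])
  next
    fix x assume "x \<in> (+) m ` ((*v) ?R ` cball 0 (sqrt (2 * a)))"
    then obtain z where z: "norm z \<le> sqrt (2 * a)" "x = m + ?R *v z" by auto
    then have "weighted_norm S (x - m) \<le> sqrt (2 * a)"
      by (simp add: weighted_norm_def sym_pos_def_mult_inv[OF R])
    then have "(weighted_norm S (x - m))\<^sup>2 \<le> (sqrt (2 * a))\<^sup>2"
      by (intro power_mono) (auto simp: weighted_norm_def)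
    then show "x \<in> {x. (weighted_norm S (x - m))\<^sup>2 / 2 \<le> a}" using a by simp
  qed
  have "det S = det ?R * det ?R" using matrix_sqrt_works(2)[OF S] by (metis det_mul)
  then have detR: "det ?R = sqrt (det S)"
    using sym_pos_def_det_pos[OF R] by (simp add: real_sqrt_mult)
  have comp: "compact ((*v) ?R ` cball 0 (sqrt (2 * a)))"
    by (intro compact_continuous_image linear_continuous_on) auto
  have "(+) m ` X = (+) (- m) -` X" for X
    by (auto intro: rev_image_eqI)
  then have "emeasure lborel ((+) m ` ((*v) ?R ` cball 0 (sqrt (2 * a)))) =
      emeasure (distr lborel borel ((+) (- m))) ((*v) ?R ` cball 0 (sqrt (2 * a)))"
    using borel_compact[OF comp] by (subst emeasure_distr) auto
  also have "\<dots> = ennreal (sqrt (det S)) * ennreal (unit_ball_vol (real CARD('n)) * sqrt (2 * a) ^ CARD('n))"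
    using a by (simp add: lborel_distr_plus emeasure_sym_pos_def_image_cball[OF R] emeasure_cball detR)
  also have "sqrt (2 * a) ^ CARD('n) = (2 * a) powr (real CARD('n) / 2)"
    using a by (cases "a = 0") (simp_all add: powr_half_sqrt[symmetric] powr_realpow[symmetric] powr_powr)
  finally show ?thesis
    unfolding eq using sym_pos_def_det_pos[OF S] by (simp add: ennreal_mult'[symmetric] mult.assoc)
qed

lemma weighted_norm_measurable [measurable]: "weighted_norm S \<in> borel_measurable borel"
  unfolding weighted_norm_def
  by (intro borel_measurable_continuous_onI continuous_intros)

text \<open>Half the squared distance is the radial variable for which the image density is a pure
  power, so that Gaussian integrals become Gamma integrals without substitution.\<close>

lemma distr_weighted_norm:
  fixes S :: "real^'n^'n"
  assumes S: "sym_pos_def S"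
  defines "p \<equiv> real CARD('n) / 2"
  shows "distr lborel borel (\<lambda>x. (weighted_norm S (x - m))\<^sup>2 / 2) =
    density lborel (\<lambda>t. ennreal (sqrt ((2 * pi) ^ CARD('n) * det S) / Gamma p * (indicator {0<..} t * t powr (p - 1))))"
    (is "?M = ?N")
proof -
  define k where "k = sqrt ((2 * pi) ^ CARD('n) * det S) / Gamma p"
  have p: "p > 0" by (simp add: p_def)
  have Gp: "Gamma p > 0" using p by simp
  have k0: "k \<ge> 0" using sym_pos_def_det_pos[OF S] Gp by (simp add: k_def)
  \<comment> \<open>The unit ball has volume \<open>pi powr p / Gamma (p + 1)\<close>; the recursion
    exposes the factor \<open>1 / p\<close> that integration of \<open>t powr (p - 1)\<close> also
    produces.\<close>
  have Gp1: "Gamma (p + 1) = p * Gamma p"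
    using p by (intro Gamma_plus1) (auto elim!: nonpos_Ints_cases)
  have sqp: "sqrt (c ^ CARD('n)) = c powr p" if "c > 0" for c
    using that by (simp add: p_def powr_half_sqrt[symmetric] powr_realpow[symmetric] powr_powr)
  have em: "emeasure ?M {..a} = ennreal (if a \<le> 0 then 0 else k * a powr p / p)" for a
  proof -
    have "emeasure ?M {..a} = emeasure lborel {x. (weighted_norm S (x - m))\<^sup>2 / 2 \<le> a}"
      by (subst emeasure_distr) (auto intro!: arg_cong[where f="emeasure lborel"])
    also have "\<dots> = ennreal (if a \<le> 0 then 0 else k * a powr p / p)"
    proof (cases "a \<ge> 0")
      case True
      have "sqrt (det S) * unit_ball_vol (real CARD('n)) * (2 * a) powr (real CARD('n) / 2) = k * a powr p / p"
        using True p Gp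
        by (simp add: k_def unit_ball_vol_def p_def[symmetric] Gp1 sqp powr_mult real_sqrt_mult mult_ac)
      then show ?thesis using weighted_norm_ellipsoid[OF S True] True by (auto simp: p_def)
    next
      case False
      then have "(weighted_norm S (x - m))\<^sup>2 / 2 > a" for x
        by (smt (verit) divide_nonneg_nonneg zero_le_power2)
      then have "{x. (weighted_norm S (x - m))\<^sup>2 / 2 \<le> a} = {}" by (auto simp: not_le)
      then show ?thesis using False by auto
    qed
    finally show ?thesis .
  qed
  have en: "emeasure ?N {..a} = ennreal (if a \<le> 0 then 0 else k * a powr p / p)" for a
  proof -
    have "emeasure ?N {..a} = (\<integral>\<^sup>+t. ennreal (k * (t powr (p - 1))) * indicator {0..a} t \<partial>lborel)"
      unfolding k_def[symmetric]
      by (subst emeasure_density) (auto intro!: nn_integral_cong split: split_indicator)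
    also have "\<dots> = ennreal (if a \<le> 0 then 0 else k * a powr p / p)"
    proof (cases "a \<ge> 0")
      case True
      have "((\<lambda>t. k * t powr (p - 1)) has_integral (k * (a powr (p - 1 + 1) / (p - 1 + 1)))) {0..a}"
        using has_integral_powr_from_0[of "p - 1" a] p True by (intro has_integral_mult_right) auto
      then have "(\<integral>\<^sup>+t. ennreal (indicator {0..a} t * (k * t powr (p - 1))) \<partial>lborel) = ennreal (k * a powr p / p)"
        using k0 by (intro nn_integral_has_integral_lebesgue) auto
      moreover have "(\<integral>\<^sup>+t. ennreal (indicator {0..a} t * (k * t powr (p - 1))) \<partial>lborel) =
        (\<integral>\<^sup>+t. ennreal (k * (t powr (p - 1))) * indicator {0..a} t \<partial>lborel)"
        by (intro nn_integral_cong) (auto split: split_indicator)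
      ultimately show ?thesis using True by auto
    qed auto
    finally show ?thesis .
  qed
  show ?thesis
  proof (rule measure_eqI_generator_eq[where E="range atMost" and \<Omega>=UNIV and A="\<lambda>i. {..real i}"])
    show "Int_stable (range atMost :: real set set)"
      by (auto simp: Int_stable_def)
    show "sets ?M = sigma_sets UNIV (range atMost)" "sets ?N = sigma_sets UNIV (range atMost)"
      by (simp_all add: borel_eq_atMost)
    show "emeasure ?M X = emeasure ?N X" if "X \<in> range atMost" for X
      using that em en by auto
    show "(\<Union>i. {..real i}) = UNIV" by (auto intro: real_arch_simple)
    show "emeasure ?M {..real i} \<noteq> \<infinity>" for i by (simp add: em)
  qed auto
qed

lemma nn_integral_Gamma:
  assumes "q > 0" "\<delta> > 0"
  shows "(\<integral>\<^sup>+t. ennreal (indicator {0<..} t * (t powr (q - 1) * exp (- \<delta> * t))) \<partial>lborel) =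
    ennreal (Gamma q / \<delta> powr q)"
proof -
  have "(\<integral>\<^sup>+t. ennreal (indicator {0<..} t * (t powr (q - 1) * exp (- \<delta> * t))) \<partial>lborel) =
    ennreal (1 / \<delta>) * (\<integral>\<^sup>+t. ennreal (indicator {0<..} (t / \<delta>) * ((t / \<delta>) powr (q - 1) * exp (- t))) \<partial>lborel)"
    using assms by (subst nn_integral_real_affine[where c="1 / \<delta>" and t=0]) simp_all
  \<comment> \<open>The indicators of \<open>{0<..}\<close> and \<open>{0..}\<close> differ only at
    0, where \<open>0 powr (q - 1)\<close> is 0 by convention, so the integrands agree there
    too.\<close>
  also have "(\<integral>\<^sup>+t. ennreal (indicator {0<..} (t / \<delta>) * ((t / \<delta>) powr (q - 1) * exp (- t))) \<partial>lborel) =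
     (\<integral>\<^sup>+t. ennreal (1 / \<delta> powr (q - 1)) * ennreal (indicator {0..} t * (t powr (q - 1) / exp t)) \<partial>lborel)"
    using assms
    by (intro nn_integral_cong)
       (auto simp: exp_minus powr_divide field_simps ennreal_mult'[symmetric] zero_less_divide_iff split: split_indicator)
  also have "\<dots> = ennreal (1 / \<delta> powr (q - 1)) * ennreal (Gamma q)"
    using nn_integral_has_integral_lebesgue[OF _ Gamma_integral_real[OF assms(1)]]
    by (subst nn_integral_cmult) simp_all
  also have "ennreal (1 / \<delta>) * \<dots> = ennreal (Gamma q / \<delta> powr q)"
    using assms by (simp add: ennreal_mult'[symmetric] powr_diff field_simps)
  finally show ?thesis .
qed

section \<open>Gaussian integrals and total variation\<close>

text \<open>Polar coordinates adapted to \<open>S\<close>. The normalising constant of the Gaussian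
  and its third absolute moment are the two instances used.\<close>

lemma nn_integral_weighted_norm:
  fixes S :: "real^'n^'n"
  assumes S: "sym_pos_def S" and [measurable]: "h \<in> borel_measurable borel" and h: "\<And>t. h t \<ge> (0::real)"
  defines "p \<equiv> real CARD('n) / 2"
  shows "(\<integral>\<^sup>+x. ennreal (h ((weighted_norm S (x - m))\<^sup>2 / 2)) \<partial>lborel) =
    ennreal (sqrt ((2 * pi) ^ CARD('n) * det S) / Gamma p) *
    (\<integral>\<^sup>+t. ennreal (indicator {0<..} t * (t powr (p - 1) * h t)) \<partial>lborel)"
proof -
  define k where "k = sqrt ((2 * pi) ^ CARD('n) * det S) / Gamma p"
  have "Gamma p > 0" by (simp add: p_def)
  then have k: "k \<ge> 0" using sym_pos_def_det_pos[OF S] by (simp add: k_def)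
  have "(\<integral>\<^sup>+x. ennreal (h ((weighted_norm S (x - m))\<^sup>2 / 2)) \<partial>lborel) =
    (\<integral>\<^sup>+t. ennreal (h t) \<partial>distr lborel borel (\<lambda>x. (weighted_norm S (x - m))\<^sup>2 / 2))"
    by (subst nn_integral_distr) simp_all
  also have "\<dots> = (\<integral>\<^sup>+t. ennreal (k * (indicator {0<..} t * t powr (p - 1))) * ennreal (h t) \<partial>lborel)"
    unfolding distr_weighted_norm[OF S] p_def[symmetric] k_def[symmetric]
    by (subst nn_integral_density) simp_all
  also have "\<dots> = (\<integral>\<^sup>+t. ennreal k * ennreal (indicator {0<..} t * (t powr (p - 1) * h t)) \<partial>lborel)"
    using k h by (intro nn_integral_cong) (simp add: ennreal_mult'[symmetric] ennreal_mult''[symmetric] mult.assoc)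
  also have "\<dots> = ennreal k * (\<integral>\<^sup>+t. ennreal (indicator {0<..} t * (t powr (p - 1) * h t)) \<partial>lborel)"
    by (rule nn_integral_cmult) simp
  finally show ?thesis by (simp add: k_def)
qed

lemma nn_integral_gaussian:
  fixes S :: "real^'n^'n"
  assumes S: "sym_pos_def S" and \<delta>: "\<delta> > 0"
  shows "(\<integral>\<^sup>+x. ennreal (exp (- \<delta> * ((weighted_norm S (x - m))\<^sup>2 / 2))) \<partial>lborel) =
    ennreal (sqrt ((2 * pi) ^ CARD('n) * det S) / \<delta> powr (real CARD('n) / 2))"
proof -
  have G: "Gamma (real CARD('n) / 2) > 0" by simp
  show ?thesis
    using sym_pos_def_det_pos[OF S] G less_imp_neq[OF G] \<delta>
    by (subst nn_integral_weighted_norm[OF S]; (subst nn_integral_Gamma)?)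
       (simp_all add: ennreal_mult'[symmetric])
qed

lemma nn_integral_gaussian_third_moment:
  fixes S :: "real^'n^'n"
  assumes S: "sym_pos_def S" and \<delta>: "\<delta> > 0"
  shows "(\<integral>\<^sup>+x. ennreal (weighted_norm S (x - m) ^ 3 * exp (- \<delta> * ((weighted_norm S (x - m))\<^sup>2 / 2))) \<partial>lborel) =
    ennreal (sqrt ((2 * pi) ^ CARD('n) * det S) * (2 * sqrt 2 * Gamma (real CARD('n) / 2 + 3/2) / Gamma (real CARD('n) / 2)
      / \<delta> powr (real CARD('n) / 2 + 3/2)))"
proof -
  let ?p = "real CARD('n) / 2"
  have p: "?p > 0" by simp
  have G: "Gamma ?p > 0" "Gamma (?p + 3/2) > 0" by simp_all
  have "(\<integral>\<^sup>+x. ennreal (weighted_norm S (x - m) ^ 3 * exp (- \<delta> * ((weighted_norm S (x - m))\<^sup>2 / 2))) \<partial>lborel) =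
    (\<integral>\<^sup>+x. ennreal ((\<lambda>t. sqrt (2 * t) ^ 3 * exp (- \<delta> * t)) ((weighted_norm S (x - m))\<^sup>2 / 2)) \<partial>lborel)"
    by (intro nn_integral_cong) (simp add: weighted_norm_def)
  \<comment> \<open>\<open>nn_integral_weighted_norm\<close> requires a profile that is nonnegative
    on the whole line, while \<open>sqrt\<close> takes negative values at negative arguments. The
    absolute value repairs this and changes nothing at the arguments that occur.\<close>
  also have "\<dots> = (\<integral>\<^sup>+x. ennreal ((\<lambda>t. \<bar>sqrt (2 * t) ^ 3\<bar> * exp (- \<delta> * t)) ((weighted_norm S (x - m))\<^sup>2 / 2)) \<partial>lborel)"
    by (intro nn_integral_cong) simp
  also have "\<dots> = ennreal (sqrt ((2 * pi) ^ CARD('n) * det S) / Gamma ?p) *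
     (\<integral>\<^sup>+t. ennreal (indicator {0<..} t * (t powr (?p - 1) * (\<bar>sqrt (2 * t) ^ 3\<bar> * exp (- \<delta> * t)))) \<partial>lborel)"
    by (rule nn_integral_weighted_norm[OF S]) simp_all
  also have "(\<integral>\<^sup>+t. ennreal (indicator {0<..} t * (t powr (?p - 1) * (\<bar>sqrt (2 * t) ^ 3\<bar> * exp (- \<delta> * t)))) \<partial>lborel) =
     (\<integral>\<^sup>+t. ennreal (2 * sqrt 2) * ennreal (indicator {0<..} t * (t powr (?p + 3/2 - 1) * exp (- \<delta> * t))) \<partial>lborel)"
  proof (rule nn_integral_cong)
    fix t :: real
    \<comment> \<open>A factor r^3 raises the power of t by 3/2 and leaves
      \<open>2 * sqrt 2\<close>; hence the argument \<open>d/2 + 3/2\<close> of Gamma in the final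
      constant.\<close>
    have "t powr (?p - 1) * sqrt (2 * t) ^ 3 = 2 * sqrt 2 * t powr (?p + 3/2 - 1)" if t: "t > 0"
    proof -
      have "sqrt (2 * t) ^ 3 = (sqrt (2 * t))\<^sup>2 * sqrt (2 * t)"
        by (simp add: power2_eq_square power3_eq_cube)
      also have "\<dots> = 2 * sqrt 2 * (t * sqrt t)"
        using t by (simp add: real_sqrt_mult power_mult_distrib)
      also have "t * sqrt t = t powr (3/2)"
        using t powr_add[of t 1 "1/2"] by (simp add: powr_half_sqrt)
      finally show ?thesis using t by (simp add: powr_add[symmetric] algebra_simps)
    qed
    then show "ennreal (indicator {0<..} t * (t powr (?p - 1) * (\<bar>sqrt (2 * t) ^ 3\<bar> * exp (- \<delta> * t)))) =
      ennreal (2 * sqrt 2) * ennreal (indicator {0<..} t * (t powr (?p + 3/2 - 1) * exp (- \<delta> * t)))"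
      by (auto simp: ennreal_mult'[symmetric] split: split_indicator)
  qed
  also have "\<dots> = ennreal (2 * sqrt 2) * ennreal (Gamma (?p + 3/2) / \<delta> powr (?p + 3/2))"
    using nn_integral_Gamma[of "?p + 3/2" \<delta>] p \<delta> by (subst nn_integral_cmult) simp_all
  also have "ennreal (sqrt ((2 * pi) ^ CARD('n) * det S) / Gamma ?p) * \<dots> =
     ennreal (sqrt ((2 * pi) ^ CARD('n) * det S) * (2 * sqrt 2 * Gamma (?p + 3/2) / Gamma ?p / \<delta> powr (?p + 3/2)))"
    using sym_pos_def_det_pos[OF S] G \<delta> by (simp add: ennreal_mult'[symmetric])
  finally show ?thesis .
qed

section \<open>Total variation between normalised densities\<close>

lemma measure_density_lborel:
  fixes g :: "'a::euclidean_space \<Rightarrow> real"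
  assumes g: "integrable lborel g" "\<And>x. g x \<ge> 0" and B: "B \<in> sets borel"
  shows "measure (density lborel (\<lambda>x. ennreal (g x))) B = (\<integral>x. g x * indicator B x \<partial>lborel)"
proof -
  have [measurable]: "g \<in> borel_measurable borel" using g(1) by auto
  have i: "integrable lborel (\<lambda>x. g x * indicator B x)"
    using integrable_mult_indicator[of B lborel g] g(1) B by (simp add: mult.commute)
  have "emeasure (density lborel (\<lambda>x. ennreal (g x))) B = (\<integral>\<^sup>+x. ennreal (g x * indicator B x) \<partial>lborel)"
    using B by (subst emeasure_density) (auto intro!: nn_integral_cong split: split_indicator)
  also have "\<dots> = ennreal (\<integral>x. g x * indicator B x \<partial>lborel)"
    using i g(2) by (intro nn_integral_eq_integral) auto
  finally show ?thesis using g(2) by (simp add: measure_def integral_nonneg_AE)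
qed

text \<open>With \<open>t\<close> the first probability of the event, the difference of the two normalised
  integrals is \<open>((1 - t) * (\<integral>\<^sub>B f - g) - t * (\<integral>\<^sub>B\<^sub>' f - g)) / \<integral>g\<close>, where \<open>B'\<close> is the complement.\<close>

lemma normalized_density_diff_le:
  fixes f g :: "'a::euclidean_space \<Rightarrow> real"
  assumes f: "integrable lborel f" "\<And>x. f x \<ge> 0" and g: "integrable lborel g" "\<And>x. g x \<ge> 0"
    and pos: "(\<integral>x. f x \<partial>lborel) > 0" "(\<integral>x. g x \<partial>lborel) > 0" and B: "B \<in> sets borel"
  shows "\<bar>measure (density lborel (\<lambda>x. ennreal (f x / (\<integral>z. f z \<partial>lborel)))) B
      - measure (density lborel (\<lambda>x. ennreal (g x / (\<integral>z. g z \<partial>lborel)))) B\<bar>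
    \<le> (\<integral>x. \<bar>f x - g x\<bar> \<partial>lborel) / (\<integral>x. g x \<partial>lborel)"
proof -
  have iB: "integrable lborel (\<lambda>x. h x * indicator E x)" if "integrable lborel h" "E \<in> sets borel"
    for h :: "'a \<Rightarrow> real" and E
    using integrable_mult_indicator[of E lborel h] that by (simp add: mult.commute)
  define Z where "Z = (\<integral>x. f x \<partial>lborel)"
  define N where "N = (\<integral>x. g x \<partial>lborel)"
  define u where "u = (\<integral>x. f x * indicator B x \<partial>lborel)"
  define v where "v = (\<integral>x. g x * indicator B x \<partial>lborel)"
  define D where "D E = (\<integral>x. \<bar>f x - g x\<bar> * indicator E x \<partial>lborel)" for E
  have C: "- B \<in> sets borel" using B by auto
  have split: "(\<integral>x. h x * indicator B x \<partial>lborel) + (\<integral>x. h x * indicator (- B) x \<partial>lborel) = (\<integral>x. h x \<partial>lborel)"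
    if "integrable lborel h" for h :: "'a \<Rightarrow> real"
  proof -
    have "(\<integral>x. h x * indicator B x \<partial>lborel) + (\<integral>x. h x * indicator (- B) x \<partial>lborel) =
        (\<integral>x. h x * indicator B x + h x * indicator (- B) x \<partial>lborel)"
      using iB[OF that B] iB[OF that C] by simp
    also have "\<dots> = (\<integral>x. h x \<partial>lborel)"
      by (intro Bochner_Integration.integral_cong) (auto split: split_indicator)
    finally show ?thesis .
  qed
  have DE: "\<bar>(\<integral>x. f x * indicator E x \<partial>lborel) - (\<integral>x. g x * indicator E x \<partial>lborel)\<bar> \<le> D E"
    if "E \<in> sets borel" for E
  proof -
    have "(\<integral>x. f x * indicator E x \<partial>lborel) - (\<integral>x. g x * indicator E x \<partial>lborel)
        = (\<integral>x. (f x - g x) * indicator E x \<partial>lborel)"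
      using iB[OF f(1) that] iB[OF g(1) that] by (simp add: left_diff_distrib)
    also have "\<bar>\<dots>\<bar> \<le> (\<integral>x. \<bar>(f x - g x) * indicator E x\<bar> \<partial>lborel)" by (rule integral_abs_bound)
    also have "\<dots> = D E" by (simp add: D_def abs_mult)
    finally show ?thesis .
  qed
  have "0 \<le> (\<integral>x. f x * indicator E x \<partial>lborel)" for E
    by (intro integral_nonneg_AE) (simp add: f(2))
  from this[of B] this[of "- B"] have u: "0 \<le> u" "u \<le> Z"
    using split[OF f(1)] by (auto simp: u_def Z_def)
  have "\<bar>u - v\<bar> \<le> D B" using DE[OF B] by (simp add: u_def v_def)
  moreover have "\<bar>(Z - u) - (N - v)\<bar> \<le> D (- B)"
    using DE[OF C] split[OF f(1)] split[OF g(1)] by (simp add: u_def v_def Z_def N_def)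
  moreover have DD: "D B + D (- B) = (\<integral>x. \<bar>f x - g x\<bar> \<partial>lborel)"
    unfolding D_def using f(1) g(1) by (intro split) auto
  define t where "t = u / Z"
  have t: "0 \<le> t" "t \<le> 1" "u = t * Z" using u pos by (auto simp: t_def Z_def)
  \<comment> \<open>Both weights lie in [0,1], so the contributions of the event and its complement
    add up to a single L1 distance. Replacing one normaliser by the other thus costs no factor
    2.\<close>
  ultimately have "\<bar>(1 - t) * (u - v)\<bar> \<le> 1 * D B" "\<bar>t * ((Z - u) - (N - v))\<bar> \<le> 1 * D (- B)"
    unfolding abs_mult by (intro mult_mono; simp)+
  then have "\<bar>(1 - t) * (u - v) - t * ((Z - u) - (N - v))\<bar> \<le> D B + D (- B)" by linarith
  moreover have "(1 - t) * (u - v) - t * ((Z - u) - (N - v)) = t * N - v"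
    using t(3) by (simp add: algebra_simps)
  ultimately have "\<bar>t * N - v\<bar> / N \<le> (D B + D (- B)) / N"
    using pos(2) by (simp add: divide_right_mono N_def)
  moreover have "\<bar>t * N - v\<bar> / N = \<bar>t - v / N\<bar>"
  proof -
    have N0: "N > 0" using pos(2) by (simp add: N_def)
    then have "t - v / N = (t * N - v) / N" by (simp add: diff_divide_distrib)
    then show ?thesis using N0 by simp
  qed
  moreover have "measure (density lborel (\<lambda>x. ennreal (f x / Z))) B = t"
    using f pos B by (subst measure_density_lborel) (auto simp: t_def u_def Z_def)
  moreover have "measure (density lborel (\<lambda>x. ennreal (g x / N))) B = v / N"
    using g pos B by (subst measure_density_lborel) (auto simp: v_def N_def)
  ultimately show ?thesis by (simp add: DD Z_def[symmetric] N_def[symmetric])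
qed

text \<open>Factor out the larger exponential and use that 1 - exp(-s) is at most s. The common
  lower bound \<open>c\<close> lets one widened Gaussian dominate both densities.\<close>

lemma exp_neg_diff_le:
  fixes a b c :: real
  assumes "c \<le> a" "c \<le> b"
  shows "\<bar>exp (- a) - exp (- b)\<bar> \<le> \<bar>a - b\<bar> * exp (- c)"
proof -
  have *: "exp (- a) - exp (- b) \<le> (b - a) * exp (- c)" if "a \<le> b" "c \<le> a" for a b
  proof -
    have "exp (- a) - exp (- b) = exp (- a) * (1 - exp (- (b - a)))"
      by (simp add: right_diff_distrib flip: exp_add)
    also have "1 - exp (- (b - a)) \<le> b - a"
      using exp_ge_add_one_self[of "- (b - a)"] by linarith
    then have "exp (- a) * (1 - exp (- (b - a))) \<le> exp (- c) * (b - a)"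
      using that by (intro mult_mono) auto
    finally show ?thesis by (simp add: mult.commute)
  qed
  show ?thesis
    using *[of a b] *[of b a] assms by (cases "a \<le> b") auto
qed

lemma sym_pos_def_scaleR: "sym_pos_def S \<Longrightarrow> c > 0 \<Longrightarrow> sym_pos_def (c *\<^sub>R S)"
  by (auto simp: sym_pos_def_def transpose_scalar scaleR_matrix_vector_assoc[symmetric] vec_eq_iff transpose_def)

lemma weighted_norm_scaleR:
  assumes S: "sym_pos_def S" and c: "c > 0"
  shows "(weighted_norm (c *\<^sub>R S) x)\<^sup>2 = (weighted_norm S x)\<^sup>2 / c"
proof -
  have "matrix_inv (c *\<^sub>R S) = (1 / c) *\<^sub>R matrix_inv S"
    using c matrix_inv_mult(1)[OF sym_pos_def_invertible[OF S]]
    by (intro matrix_inv_eqI) (simp add: scalar_matrix_assoc[symmetric] matrix_scalar_ac)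
  then show ?thesis
    by (simp add: weighted_norm_sq S sym_pos_def_scaleR c scaleR_matrix_vector_assoc[symmetric])
qed

text \<open>The hypothesis \<open>lower\<close> places both exponents above \<open>\<delta>\<close>
  times the Gaussian one, so the L1 distance of the unnormalised densities is at most the integral
  of a cubic against a widened Gaussian. Its third moment contains the normaliser \<open>N\<close>
  as a factor, which cancels on division.\<close>

lemma tv_dist_laplace_le:
  fixes \<Phi> :: "real^'n \<Rightarrow> real" and S :: "real^'n^'n"
  assumes S: "sym_pos_def S" and \<epsilon>: "\<epsilon> > 0" and \<delta>: "0 < \<delta>" "\<delta> \<le> 1" and K: "K \<ge> 0"
    and [measurable]: "\<Phi> \<in> borel_measurable borel"
    and upper: "\<And>x. \<bar>\<Phi> x - (weighted_norm S (x - m))\<^sup>2 / 2\<bar> \<le> K / 6 * weighted_norm S (x - m) ^ 3"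
    and lower: "\<And>x. \<delta> * ((weighted_norm S (x - m))\<^sup>2 / 2) \<le> \<Phi> x"
  shows "tv_dist (posterior \<epsilon> \<Phi>) (gaussian m (\<epsilon> *\<^sub>R S)) \<le>
    sqrt 2 / 3 * (Gamma (real CARD('n) / 2 + 3/2) / Gamma (real CARD('n) / 2)) / \<delta> powr (real CARD('n) / 2 + 3/2) * K * sqrt \<epsilon>"
proof -
  let ?T = "\<epsilon> *\<^sub>R S"
  define r where "r x = weighted_norm ?T (x - m)" for x
  define f where "f x = exp (- \<Phi> x / \<epsilon>)" for x
  define q where "q x = exp (- ((r x)\<^sup>2 / 2))" for x
  define N where "N = sqrt ((2 * pi) ^ CARD('n) * det ?T)"
  have T: "sym_pos_def ?T" by (rule sym_pos_def_scaleR[OF S \<epsilon>])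
  have N: "N > 0" using sym_pos_def_det_pos[OF T] by (simp add: N_def)
  have [measurable]: "r \<in> borel_measurable borel" unfolding r_def by measurable
  have [measurable]: "f \<in> borel_measurable borel" "q \<in> borel_measurable borel"
    unfolding f_def q_def by measurable
  have r0: "r x \<ge> 0" for x by (simp add: r_def weighted_norm_def)
  have w: "weighted_norm S (x - m) = sqrt \<epsilon> * r x" for x
  proof -
    have "(weighted_norm S (x - m))\<^sup>2 = (sqrt \<epsilon> * r x)\<^sup>2"
      using weighted_norm_scaleR[OF S \<epsilon>, of "x - m"] \<epsilon> by (simp add: r_def power_mult_distrib)
    then show ?thesis using r0[of x] \<epsilon> by (simp add: weighted_norm_def)
  qed
  have fint: "integrable lborel f" and qint: "integrable lborel q" and qN: "(\<integral>x. q x \<partial>lborel) = N"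
  proof -
    have g: "integrable lborel (\<lambda>x. exp (- d * ((r x)\<^sup>2 / 2)))" if "d > 0" for d
    proof (rule integrableI_nonneg)
      show "(\<integral>\<^sup>+x. ennreal (exp (- d * ((r x)\<^sup>2 / 2))) \<partial>lborel) < \<infinity>"
        unfolding r_def nn_integral_gaussian[OF T that] by simp
    qed auto
    show "integrable lborel f"
    proof (rule Bochner_Integration.integrable_bound[OF g[OF \<delta>(1)]])
      have "\<delta> * ((r x)\<^sup>2 / 2) \<le> \<Phi> x / \<epsilon>" for x
        using lower[of x] \<epsilon> by (simp add: w power_mult_distrib field_simps)
      then show "AE x in lborel. norm (f x) \<le> norm (exp (- \<delta> * ((r x)\<^sup>2 / 2)))"
        by (simp add: f_def)
    qed simp
    show "integrable lborel q" unfolding q_def[abs_def] using g[of 1] by simp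
    have "ennreal (\<integral>x. q x \<partial>lborel) = (\<integral>\<^sup>+x. ennreal (q x) \<partial>lborel)"
      using \<open>integrable lborel q\<close> by (intro nn_integral_eq_integral[symmetric]) (simp, simp add: q_def)
    also have "\<dots> = ennreal N"
      using nn_integral_gaussian[OF T, of 1 m] by (simp add: q_def r_def N_def)
    finally show "(\<integral>x. q x \<partial>lborel) = N"
      using N by (simp add: integral_nonneg_AE q_def)
  qed
  have f0: "f x \<ge> 0" and q0: "q x \<ge> 0" for x by (simp_all add: f_def q_def)
  have fpos: "(\<integral>x. f x \<partial>lborel) > 0"
  proof -
    \<comment> \<open>A positive function with integral zero would vanish almost everywhere, which
      is impossible because Lebesgue measure is not the null measure.\<close>
    have "\<not> (AE x::real^'n in lborel. False)"
      using ae_filter_eq_bot_iff[of "lborel :: (real^'n) measure"] by (simp add: trivial_limit_def)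
    then have "(\<integral>x. f x \<partial>lborel) \<noteq> 0"
      using fint by (subst integral_nonneg_eq_0_iff_AE) (auto simp: f_def)
    moreover have "(\<integral>x. f x \<partial>lborel) \<ge> 0" by (simp add: integral_nonneg_AE f_def)
    ultimately show ?thesis by simp
  qed
  define J where "J = 2 * sqrt 2 * Gamma (real CARD('n) / 2 + 3/2) / Gamma (real CARD('n) / 2) / \<delta> powr (real CARD('n) / 2 + 3/2)"
  have J: "J \<ge> 0" by (simp add: J_def)
  have "ennreal (\<integral>x. \<bar>f x - q x\<bar> \<partial>lborel) = (\<integral>\<^sup>+x. ennreal \<bar>f x - q x\<bar> \<partial>lborel)"
    using fint qint by (intro nn_integral_eq_integral[symmetric]) auto
  also have "\<dots> \<le> (\<integral>\<^sup>+x. ennreal (K * sqrt \<epsilon> / 6) * ennreal (r x ^ 3 * exp (- \<delta> * ((r x)\<^sup>2 / 2))) \<partial>lborel)"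
  proof (rule nn_integral_mono)
    fix x
    have "\<bar>f x - q x\<bar> \<le> \<bar>\<Phi> x / \<epsilon> - (r x)\<^sup>2 / 2\<bar> * exp (- (\<delta> * ((r x)\<^sup>2 / 2)))"
      unfolding f_def q_def minus_divide_left[symmetric]
    proof (rule exp_neg_diff_le)
      show "\<delta> * ((r x)\<^sup>2 / 2) \<le> \<Phi> x / \<epsilon>"
        using lower[of x] \<epsilon> by (simp add: w power_mult_distrib field_simps)
      show "\<delta> * ((r x)\<^sup>2 / 2) \<le> (r x)\<^sup>2 / 2" using \<delta> by (intro mult_left_le_one_le) auto
    qed
    also have "\<bar>\<Phi> x / \<epsilon> - (r x)\<^sup>2 / 2\<bar> \<le> K * sqrt \<epsilon> / 6 * r x ^ 3"
    proof -
      \<comment> \<open>In the metric of \<open>?T\<close> distances shrink by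
        \<open>sqrt \<epsilon>\<close>. Its cube, divided by the \<open>\<epsilon>\<close> of the
        exponent, leaves \<open>sqrt \<epsilon>\<close>: this is the rate.\<close>
      have "\<bar>\<Phi> x / \<epsilon> - (r x)\<^sup>2 / 2\<bar> = \<bar>\<Phi> x - (sqrt \<epsilon> * r x)\<^sup>2 / 2\<bar> / \<epsilon>"
        using \<epsilon> by (subst abs_div_pos) (simp_all add: power_mult_distrib diff_divide_distrib)
      also have "\<dots> \<le> K / 6 * (sqrt \<epsilon> * r x) ^ 3 / \<epsilon>"
        using upper[of x] \<epsilon> by (intro divide_right_mono) (simp_all add: w)
      also have "\<dots> = K * sqrt \<epsilon> / 6 * r x ^ 3"
      proof -
        have "sqrt \<epsilon> ^ 3 = \<epsilon> * sqrt \<epsilon>" using \<epsilon> by (simp add: power3_eq_cube)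
        then show ?thesis using \<epsilon> by (simp add: power_mult_distrib)
      qed
      finally show ?thesis .
    qed
    finally have "\<bar>f x - q x\<bar> \<le> K * sqrt \<epsilon> / 6 * (r x ^ 3 * exp (- \<delta> * ((r x)\<^sup>2 / 2)))"
      by (simp add: mult_ac mult_right_mono)
    then show "ennreal \<bar>f x - q x\<bar> \<le> ennreal (K * sqrt \<epsilon> / 6) * ennreal (r x ^ 3 * exp (- \<delta> * ((r x)\<^sup>2 / 2)))"
      using K \<epsilon> by (simp add: ennreal_mult'[symmetric] ennreal_leI)
  qed
  also have "\<dots> = ennreal (K * sqrt \<epsilon> / 6) * ennreal (N * J)"
    unfolding r_def N_def J_def
    by (subst nn_integral_cmult) (simp_all only: nn_integral_gaussian_third_moment[OF T \<delta>(1)], measurable)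
  also have "\<dots> = ennreal (K * sqrt \<epsilon> / 6 * (N * J))"
    using K \<epsilon> by (simp add: ennreal_mult'[symmetric])
  finally have "(\<integral>x. \<bar>f x - q x\<bar> \<partial>lborel) \<le> K * sqrt \<epsilon> / 6 * (N * J)"
    using K \<epsilon> N J by (simp add: ennreal_le_iff)
  then have bd: "(\<integral>x. \<bar>f x - q x\<bar> \<partial>lborel) / N \<le> K * sqrt \<epsilon> / 6 * J"
    using N by (simp add: field_simps)
  have "posterior \<epsilon> \<Phi> = density lborel (\<lambda>x. ennreal (f x / (\<integral>z. f z \<partial>lborel)))"
    by (simp add: posterior_def f_def)
  moreover have "gaussian m ?T = density lborel (\<lambda>x. ennreal (q x / N))"
    by (simp add: gaussian_def N_def r_def q_def)
  ultimately have "tv_dist (posterior \<epsilon> \<Phi>) (gaussian m ?T) \<le> (\<integral>x. \<bar>f x - q x\<bar> \<partial>lborel) / N"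
    unfolding tv_dist_def
    using normalized_density_diff_le[OF fint f0 qint q0 fpos, unfolded qN, OF N]
    by (intro cSUP_least) auto
  also have "\<dots> \<le> K * sqrt \<epsilon> / 6 * J" by (rule bd)
  finally show ?thesis by (simp add: J_def field_simps)
qed

section \<open>Iterated derivatives and weighted norms\<close>

lemma C_class_differentiable: "C_class (Suc k) f \<Longrightarrow> f differentiable at x"
  by simp

lemma C_class_deriv: "C_class (Suc k) f \<Longrightarrow> C_class k (\<lambda>x. frechet_derivative f (at x) h)"
  by simp

lemma C_class_SucD: "C_class (Suc n) f \<Longrightarrow> C_class n f"
proof (induction n arbitrary: f)
  case 0
  then show ?case
    by (auto intro!: differentiable_imp_continuous_on simp: differentiable_on_def differentiable_at_withinI)
next
  case (Suc n)
  from Suc.IH[OF C_class_deriv[OF Suc.prems]] C_class_differentiable[OF Suc.prems]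
  show ?case unfolding C_class.simps(2) by blast
qed

lemma C_class_mono: "m \<le> n \<Longrightarrow> C_class n f \<Longrightarrow> C_class m f"
  by (induction rule: inc_induct) (auto dest: C_class_SucD simp del: C_class.simps)

lemma C_class_iter_deriv: "C_class (n + length hs) f \<Longrightarrow> C_class n (iter_deriv f hs)"
proof (induction hs arbitrary: n)
  case (Cons h hs)
  from Cons.IH[of "Suc n"] Cons.prems show ?case by (simp del: C_class.simps(1))
qed simp

lemma iter_deriv_differentiable:
  assumes "C_class n f" "length hs < n"
  shows "iter_deriv f hs differentiable at x"
proof -
  obtain k where "n = Suc k + length hs" using assms(2)
    by (metis add.commute less_imp_add_positive add_Suc_right Suc_pred' add_Suc)
  then have "C_class (Suc k) (iter_deriv f hs)" using assms(1) C_class_iter_deriv by blast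
  then show ?thesis by simp
qed

lemma iter_deriv_has_derivative:
  assumes "C_class n f" "length hs < n"
  shows "(iter_deriv f hs has_derivative (\<lambda>h. iter_deriv f (h # hs) x)) (at x)"
  using frechet_derivative_works[THEN iffD1, OF iter_deriv_differentiable[OF assms]] by simp

text \<open>The head of the list is differentiated last, whereas \<open>C_class\<close> speaks about
  the first derivative taken. Splitting off the last entry is therefore what brings the regularity
  hypothesis into an induction.\<close>

lemma iter_deriv_append:
  "iter_deriv f (hs @ [h]) = iter_deriv (\<lambda>x. frechet_derivative f (at x) h) hs"
  by (induction hs) auto

lemma iter_deriv_sum:
  assumes "\<And>b. b \<in> B \<Longrightarrow> C_class n (f b)" "length hs \<le> n"
  shows "iter_deriv (\<lambda>x. \<Sum>b\<in>B. c b *\<^sub>R f b x) hs x = (\<Sum>b\<in>B. c b *\<^sub>R iter_deriv (f b) hs x)"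
  using assms(2)
proof (induction hs arbitrary: x)
  case (Cons h hs)
  then have "iter_deriv (\<lambda>x. \<Sum>b\<in>B. c b *\<^sub>R f b x) hs = (\<lambda>x. \<Sum>b\<in>B. c b *\<^sub>R iter_deriv (f b) hs x)"
    by auto
  moreover have "((\<lambda>x. \<Sum>b\<in>B. c b *\<^sub>R iter_deriv (f b) hs x) has_derivative
      (\<lambda>h. \<Sum>b\<in>B. c b *\<^sub>R iter_deriv (f b) (h # hs) x)) (at x)"
    using assms(1) Cons.prems
    by (intro has_derivative_sum has_derivative_scaleR_right iter_deriv_has_derivative) auto
  ultimately have "(iter_deriv (\<lambda>x. \<Sum>b\<in>B. c b *\<^sub>R f b x) hs has_derivative
      (\<lambda>h. \<Sum>b\<in>B. c b *\<^sub>R iter_deriv (f b) (h # hs) x)) (at x)" by simp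
  then show ?case by (simp add: frechet_derivative_at[symmetric])
qed simp

text \<open>The innermost derivative is linear in its direction; its basis expansion is a finite
  combination that the remaining derivatives pass through.\<close>

lemma iter_deriv_snoc_sum:
  fixes f :: "'a::euclidean_space \<Rightarrow> 'b::euclidean_space"
  assumes "C_class n f" "length hs < n"
  shows "iter_deriv f (hs @ [h]) x = (\<Sum>b\<in>Basis. (h \<bullet> b) *\<^sub>R iter_deriv f (hs @ [b]) x)"
proof -
  obtain k where k: "n = Suc k" using assms(2) by (cases n) auto
  have lin: "linear (frechet_derivative f (at x))" for x
    using assms(1) unfolding k by (auto intro: linear_frechet_derivative)
  have "(\<lambda>x. frechet_derivative f (at x) h) =
      (\<lambda>x. \<Sum>b\<in>Basis. (h \<bullet> b) *\<^sub>R frechet_derivative f (at x) b)"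
    by (subst (1) euclidean_representation[symmetric, of h])
       (simp add: linear_sum[OF lin] linear_scale[OF lin])
  then show ?thesis
    using iter_deriv_sum[of Basis k "\<lambda>b x. frechet_derivative f (at x) b" hs "\<lambda>b. h \<bullet> b" x] assms
    by (simp add: iter_deriv_append k)
qed

text \<open>Only finitely many basis directions occur in the last slot, so their constants from the
  induction hypothesis can be summed. \<open>f\<close> is generalised because the hypothesis is
  applied to its first derivatives.\<close>

lemma iter_deriv_bound:
  fixes f :: "'a::euclidean_space \<Rightarrow> 'b::euclidean_space"
  shows "C_class n f \<Longrightarrow> \<exists>K\<ge>0. \<forall>hs. length hs = n \<longrightarrow> norm (iter_deriv f hs x) \<le> K * prod_list (map norm hs)"
proof (induction n arbitrary: f)
  case 0
  then show ?case by (auto intro!: exI[of _ "norm (f x)"])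
next
  case (Suc n)
  then have "\<forall>b. \<exists>K\<ge>0. \<forall>hs. length hs = n \<longrightarrow>
      norm (iter_deriv (\<lambda>x. frechet_derivative f (at x) b) hs x) \<le> K * prod_list (map norm hs)"
    by simp
  then obtain K where K: "\<And>b. K b \<ge> 0" "\<And>b hs. length hs = n \<Longrightarrow>
      norm (iter_deriv f (hs @ [b]) x) \<le> K b * prod_list (map norm hs)"
    unfolding iter_deriv_append by metis
  have "norm (iter_deriv f hs x) \<le> (\<Sum>b\<in>Basis. K b) * prod_list (map norm hs)"
    if hs: "length hs = Suc n" for hs
  proof -
    obtain gs h where gs: "hs = gs @ [h]" "length gs = n"
      using hs by (metis length_append_singleton length_0_conv nat.distinct(1) old.nat.inject rev_exhaust)
    have "norm (iter_deriv f hs x) \<le> (\<Sum>b\<in>Basis. norm ((h \<bullet> b) *\<^sub>R iter_deriv f (gs @ [b]) x))"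
      unfolding gs(1) by (subst iter_deriv_snoc_sum[OF Suc.prems]) (use gs in simp, rule norm_sum)
    also have "\<dots> \<le> (\<Sum>b\<in>Basis. norm h * (K b * prod_list (map norm gs)))"
      by (intro sum_mono) (use K gs in \<open>auto intro!: mult_mono Basis_le_norm\<close>)
    finally show ?thesis by (simp add: gs sum_distrib_left sum_distrib_right mult_ac)
  qed
  then show ?case using K by (intro exI[of _ "\<Sum>b\<in>Basis. K b"]) (auto intro: sum_nonneg)
qed

lemma norm_le_weighted_norm:
  assumes "sym_pos_def S"
  obtains c where "c > 0" "\<And>h. norm h \<le> c * weighted_norm S h"
proof
  let ?R = "matrix_sqrt S"
  \<comment> \<open>The summand 1 makes the constant strictly positive.\<close>
  show "norm h \<le> (onorm ((*v) ?R) + 1) * weighted_norm S h" for h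
  proof -
    have "norm h = norm (?R *v (matrix_inv ?R *v h))"
      by (simp add: sym_pos_def_mult_inv[OF matrix_sqrt_works(1)[OF assms]])
    also have "\<dots> \<le> onorm ((*v) ?R) * weighted_norm S h"
      unfolding weighted_norm_def by (rule onorm) simp
    also have "\<dots> \<le> (onorm ((*v) ?R) + 1) * weighted_norm S h"
      by (simp add: weighted_norm_def algebra_simps)
    finally show ?thesis .
  qed
  show "onorm ((*v) ?R) + 1 > 0" using onorm_pos_le[of "(*v) ?R"] by simp
qed

text \<open>The supremum in \<^const>\<open>deriv_norm\<close> is a supremum of reals, so it only bounds the values
  because the set is bounded above.\<close>

lemma iter_deriv_le_deriv_norm:
  assumes "sym_pos_def S" "C_class j F" "length hs = j" "\<And>h. h \<in> set hs \<Longrightarrow> weighted_norm S h \<le> 1"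
  shows "norm (iter_deriv F hs x) \<le> deriv_norm j F S x"
  unfolding deriv_norm_def
proof (rule cSup_upper)
  let ?A = "{norm (iter_deriv F hs x) | hs. length hs = j \<and> (\<forall>h\<in>set hs. weighted_norm S h \<le> 1)}"
  show "norm (iter_deriv F hs x) \<in> ?A" using assms by auto
  obtain K where K: "K \<ge> 0" "\<And>hs. length hs = j \<Longrightarrow> norm (iter_deriv F hs x) \<le> K * prod_list (map norm hs)"
    using iter_deriv_bound[OF assms(2)] by blast
  obtain c where c: "c > 0" "\<And>h. norm h \<le> c * weighted_norm S h"
    using norm_le_weighted_norm[OF assms(1)] by blast
  have "norm (iter_deriv F hs x) \<le> K * c ^ j" if "length hs = j" "\<forall>h\<in>set hs. weighted_norm S h \<le> 1" for hs
  proof -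
    have h: "norm h \<le> c" if "h \<in> set hs" for h
    proof -
      have "c * weighted_norm S h \<le> c * 1" using c(1) \<open>\<forall>h\<in>set hs. _\<close> that by (intro mult_left_mono) auto
      with c(2)[of h] show ?thesis by simp
    qed
    have "prod_list (map norm hs) \<le> c ^ length hs"
      using h
    proof (induction hs)
      case (Cons a hs)
      have "prod_list (map norm hs) \<ge> 0" by (induction hs) auto
      with Cons c(1) show ?case by (auto intro!: mult_mono)
    qed simp
    then show ?thesis using K(2)[OF that(1)] K(1) that(1) by (meson mult_left_mono order_trans)
  qed
  then show "bdd_above ?A" by (intro bdd_aboveI[of _ "K * c ^ j"]) auto
qed

section \<open>Derivatives of the negative log posterior\<close>

declare iter_deriv.simps(2) [simp del]

lemma iter_deriv_line:
  fixes F :: "'a::euclidean_space \<Rightarrow> 'b::euclidean_space"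
  assumes "C_class n F" "length hs < n"
  shows "((\<lambda>s. iter_deriv F hs (x + s *\<^sub>R h)) has_vector_derivative iter_deriv F (h # hs) (x + s *\<^sub>R h)) (at s)"
proof -
  note d = iter_deriv_has_derivative[OF assms, of "x + s *\<^sub>R h"]
  have "((\<lambda>s. iter_deriv F hs (x + s *\<^sub>R h)) has_derivative (\<lambda>t. iter_deriv F ((t *\<^sub>R h) # hs) (x + s *\<^sub>R h))) (at s)"
    by (rule has_derivative_compose[of "\<lambda>s. x + s *\<^sub>R h" "\<lambda>t. t *\<^sub>R h" s UNIV
          "iter_deriv F hs" "\<lambda>k. iter_deriv F (k # hs) (x + s *\<^sub>R h)"])
       (auto intro!: derivative_eq_intros d)
  moreover have "iter_deriv F ((t *\<^sub>R h) # hs) (x + s *\<^sub>R h) = t *\<^sub>R iter_deriv F (h # hs) (x + s *\<^sub>R h)" for t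
    using linear_scale[OF has_derivative_linear[OF d]] .
  ultimately show ?thesis by (simp add: has_vector_derivative_def)
qed

lemma has_real_derivative_inner:
  assumes "(a has_vector_derivative a') (at s)" "(b has_vector_derivative b') (at s)"
  shows "((\<lambda>s. a s \<bullet> b s) has_real_derivative (a s \<bullet> b' + a' \<bullet> b s)) (at s)"
  using bounded_bilinear.has_vector_derivative[OF bounded_bilinear_inner assms]
  by (simp add: has_real_derivative_iff_has_vector_derivative)

text \<open>The two slots are linear for different reasons: the head is the direction of a Frechet
  derivative, while the last entry is handled by its basis expansion.\<close>

lemma bilinear_iter_deriv:
  fixes F :: "'a::euclidean_space \<Rightarrow> 'b::euclidean_space"
  assumes "C_class 2 F"
  shows "bilinear (\<lambda>h k. iter_deriv F [h, k] x)"
  unfolding bilinear_def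
proof (intro conjI allI)
  show "linear (\<lambda>h. iter_deriv F [h, k] x)" for k
    using has_derivative_linear[OF iter_deriv_has_derivative[OF assms, of "[k]"]] by simp
  have snoc: "iter_deriv F [h, k] x = (\<Sum>b\<in>Basis. (k \<bullet> b) *\<^sub>R iter_deriv F [h, b] x)" for h k
    using iter_deriv_snoc_sum[OF assms, of "[h]" k x] by simp
  have eq: "(\<lambda>k. iter_deriv F [h, k] x) = (\<lambda>k. \<Sum>b\<in>Basis. (k \<bullet> b) *\<^sub>R iter_deriv F [h, b] x)" for h
    by (rule ext) (rule snoc)
  have lin: "linear (\<lambda>k. \<Sum>b\<in>Basis. (k \<bullet> b) *\<^sub>R iter_deriv F [h, b] x)" for h
    by (intro linear_compose_sum ballI linearI) (auto simp: inner_add_left scaleR_add_left)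
  show "linear (\<lambda>k. iter_deriv F [h, k] x)" for h by (subst eq) (rule lin)
qed

lemma bilinear_quadratic_form:
  fixes b :: "real^'n \<Rightarrow> real^'n \<Rightarrow> real"
  assumes "bilinear b"
  shows "v \<bullet> ((\<chi> i j. b (axis i 1) (axis j 1)) *v v) = b v v"
proof -
  have v: "(\<Sum>i\<in>UNIV. v $ i *\<^sub>R axis i 1) = v"
    using basis_expansion[of v] by (simp add: scalar_mult_eq_scaleR)
  have "b v v = b (\<Sum>i\<in>UNIV. v $ i *\<^sub>R axis i 1) (\<Sum>j\<in>UNIV. v $ j *\<^sub>R axis j 1)" unfolding v ..
  also have "\<dots> = (\<Sum>(i, j)\<in>UNIV \<times> UNIV. b (v $ i *\<^sub>R axis i 1) (v $ j *\<^sub>R axis j 1))"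
    by (rule bilinear_sum[OF assms])
  also have "\<dots> = (\<Sum>i\<in>UNIV. \<Sum>j\<in>UNIV. b (v $ i *\<^sub>R axis i 1) (v $ j *\<^sub>R axis j 1))"
    by (rule sum.cartesian_product[symmetric])
  also have "\<dots> = v \<bullet> ((\<chi> i j. b (axis i 1) (axis j 1)) *v v)"
    by (simp add: inner_vec_def matrix_vector_mult_def bilinear_lmul[OF assms] bilinear_rmul[OF assms]
        sum_distrib_left mult_ac)
  finally show ?thesis ..
qed

context
  fixes \<epsilon> \<tau> c :: real and A S0 L :: "real^'n^'n" and F :: "real^'n \<Rightarrow> real^'n" and m0 y :: "real^'n"
    and \<Phi> :: "real^'n \<Rightarrow> real"
  defines "L \<equiv> matrix_inv (matrix_sqrt S0)"
    and "\<Phi> \<equiv> neg_log_posterior \<epsilon> A F m0 S0 y c \<tau>"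
  assumes F: "C_class 3 F"
begin

lemma neg_log_posterior_inner:
  "\<Phi> x = 1/2 * ((A *v x + \<tau> *\<^sub>R F x - y) \<bullet> (A *v x + \<tau> *\<^sub>R F x - y))
     + \<epsilon>/2 * ((L *v (x - m0)) \<bullet> (L *v (x - m0))) + c"
  by (simp add: \<Phi>_def neg_log_posterior_def forward_map_def weighted_norm_def L_def power2_norm_eq_inner)

lemma has_derivative_mult_vec: "((\<lambda>x. B *v x) has_derivative (\<lambda>k. B *v k)) (at x)" for B :: "real^'n^'n"
  by (rule bounded_linear_imp_has_derivative) simp

lemma residual_has_derivative:
  "((\<lambda>x. A *v x + \<tau> *\<^sub>R F x - y) has_derivative (\<lambda>k. A *v k + \<tau> *\<^sub>R iter_deriv F [k] x)) (at x)"
proof -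
  have "(F has_derivative (\<lambda>k. iter_deriv F [k] x)) (at x)"
    using iter_deriv_has_derivative[OF F, of "[]"] by simp
  from has_derivative_diff[OF has_derivative_add[OF has_derivative_mult_vec[of A]
        has_derivative_scaleR_right[OF this, of \<tau>]] has_derivative_const[of y]]
  show ?thesis by simp
qed

lemma prior_residual_has_derivative: "((\<lambda>x. L *v (x - m0)) has_derivative (\<lambda>k. L *v k)) (at x)"
  unfolding matrix_vector_mult_diff_distrib
  using has_derivative_diff[OF has_derivative_mult_vec[of L] has_derivative_const[of "L *v m0"]] by simp

lemma neg_log_posterior_has_derivative:
  "(\<Phi> has_derivative (\<lambda>k. (A *v k + \<tau> *\<^sub>R iter_deriv F [k] x) \<bullet> (A *v x + \<tau> *\<^sub>R F x - y)
      + \<epsilon> * ((L *v k) \<bullet> (L *v (x - m0))))) (at x)"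
  unfolding neg_log_posterior_inner[abs_def]
  by (rule has_derivative_eq_rhs[OF has_derivative_add[OF has_derivative_add[OF
        has_derivative_mult_right[OF has_derivative_inner[OF residual_has_derivative residual_has_derivative], of "1/2"]
        has_derivative_mult_right[OF has_derivative_inner[OF prior_residual_has_derivative prior_residual_has_derivative],
          of "\<epsilon>/2"]] has_derivative_const[of c]]])
     (simp add: fun_eq_iff inner_commute)

lemma iter_deriv_neg_log_posterior_1:
  "iter_deriv \<Phi> [k] x = (A *v k + \<tau> *\<^sub>R iter_deriv F [k] x) \<bullet> (A *v x + \<tau> *\<^sub>R F x - y)
      + \<epsilon> * ((L *v k) \<bullet> (L *v (x - m0)))"
  using fun_cong[OF frechet_derivative_at[OF neg_log_posterior_has_derivative[of x]], of k]
  by (simp add: iter_deriv.simps(2))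

lemma iter_deriv_neg_log_posterior_has_derivative:
  "(iter_deriv \<Phi> [k] has_derivative (\<lambda>h. (A *v k + \<tau> *\<^sub>R iter_deriv F [k] x) \<bullet> (A *v h + \<tau> *\<^sub>R iter_deriv F [h] x)
      + (\<tau> *\<^sub>R iter_deriv F [h, k] x) \<bullet> (A *v x + \<tau> *\<^sub>R F x - y) + \<epsilon> * ((L *v k) \<bullet> (L *v h)))) (at x)"
proof -
  have "(iter_deriv F [k] has_derivative (\<lambda>h. iter_deriv F [h, k] x)) (at x)"
    using iter_deriv_has_derivative[OF F, of "[k]"] by simp
  from has_derivative_add[OF has_derivative_const[of "A *v k"] has_derivative_scaleR_right[OF this, of \<tau>]]
  have u: "((\<lambda>x. A *v k + \<tau> *\<^sub>R iter_deriv F [k] x) has_derivative (\<lambda>h. \<tau> *\<^sub>R iter_deriv F [h, k] x)) (at x)"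
    by simp
  show ?thesis
    unfolding iter_deriv_neg_log_posterior_1[abs_def]
    by (rule has_derivative_eq_rhs[OF has_derivative_add[OF has_derivative_inner[OF u residual_has_derivative]
          has_derivative_mult_right[OF has_derivative_inner[OF has_derivative_const[of "L *v k"]
            prior_residual_has_derivative], of \<epsilon>]]])
       (simp add: fun_eq_iff)
qed

lemma iter_deriv_neg_log_posterior_2:
  "iter_deriv \<Phi> [h, k] x = (A *v k + \<tau> *\<^sub>R iter_deriv F [k] x) \<bullet> (A *v h + \<tau> *\<^sub>R iter_deriv F [h] x)
      + (\<tau> *\<^sub>R iter_deriv F [h, k] x) \<bullet> (A *v x + \<tau> *\<^sub>R F x - y) + \<epsilon> * ((L *v k) \<bullet> (L *v h))"
  using fun_cong[OF frechet_derivative_at[OF iter_deriv_neg_log_posterior_has_derivative[of k x]], of h]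
  by (simp only: iter_deriv.simps(2)[of \<Phi> h "[k]"])

text \<open>\<open>hessian\<close> is defined by entries on the coordinate axes; bilinearity, read
  off the explicit second derivative, extends it to the direction of an arbitrary ray.\<close>

lemma hessian_neg_log_posterior: "v \<bullet> (hessian \<Phi> x *v v) = iter_deriv \<Phi> [v, v] x"
proof -
  have F1: "linear (\<lambda>k. iter_deriv F [k] x)"
    using has_derivative_linear[OF iter_deriv_has_derivative[OF F, of "[]" x]] by simp
  note B = bilinear_iter_deriv[OF C_class_mono[OF _ F], of x, simplified]
  have "bilinear (\<lambda>h k. iter_deriv \<Phi> [h, k] x)"
    unfolding iter_deriv_neg_log_posterior_2 bilinear_def
    by (intro conjI allI linearI)
       (simp_all add: linear_add[OF F1] linear_scale[OF F1] bilinear_ladd[OF B] bilinear_radd[OF B]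
         bilinear_lmul[OF B] bilinear_rmul[OF B] matrix_vector_right_distrib matrix_vector_mult_scaleR
         inner_add_left inner_add_right algebra_simps)
  from bilinear_quadratic_form[OF this, of v] show ?thesis by (simp add: hessian_def)
qed

text \<open>The residual \<open>g\<close> has velocity \<open>u\<close>, and the derivative of
  \<open>u\<close> is \<tau> times a second derivative of \<open>F\<close>. The linear part of the
  forward map and the prior term are at most quadratic along the ray, so each term of the third
  derivative carries a factor \<open>\<tau>\<close>.\<close>

lemma neg_log_posterior_line_derivs:
  fixes x h :: "real^'n"
  defines "X \<equiv> \<lambda>s. x + s *\<^sub>R h"
  shows "((\<lambda>s. \<Phi> (X s)) has_real_derivative iter_deriv \<Phi> [h] (X s)) (at s)"
    and "((\<lambda>s. iter_deriv \<Phi> [h] (X s)) has_real_derivative iter_deriv \<Phi> [h, h] (X s)) (at s)"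
    and "((\<lambda>s. iter_deriv \<Phi> [h, h] (X s)) has_real_derivative
          3 * \<tau> * ((A *v h + \<tau> *\<^sub>R iter_deriv F [h] (X s)) \<bullet> iter_deriv F [h, h] (X s))
          + \<tau> * (iter_deriv F [h, h, h] (X s) \<bullet> (A *v X s + \<tau> *\<^sub>R F (X s) - y))) (at s)"
proof -
  have X: "(X has_vector_derivative h) (at s)"
    unfolding X_def has_vector_derivative_def by (auto intro!: derivative_eq_intros)
  have f0: "((\<lambda>s. F (X s)) has_vector_derivative iter_deriv F [h] (X s)) (at s)"
    using iter_deriv_line[OF F, of "[]" x h s] by (simp add: X_def)
  have f1: "((\<lambda>s. iter_deriv F [h] (X s)) has_vector_derivative iter_deriv F [h, h] (X s)) (at s)"
    using iter_deriv_line[OF F, of "[h]" x h s] by (simp add: X_def)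
  have f2: "((\<lambda>s. iter_deriv F [h, h] (X s)) has_vector_derivative iter_deriv F [h, h, h] (X s)) (at s)"
    using iter_deriv_line[OF F, of "[h, h]" x h s] by (simp add: X_def)
  have mv: "((\<lambda>s. B *v X s) has_vector_derivative B *v h) (at s)" for B :: "real^'n^'n"
    by (rule bounded_linear.has_vector_derivative[OF _ X]) simp
  define g where "g s = A *v X s + \<tau> *\<^sub>R F (X s) - y" for s
  define u where "u s = A *v h + \<tau> *\<^sub>R iter_deriv F [h] (X s)" for s
  have "((\<lambda>s. \<tau> *\<^sub>R F (X s)) has_vector_derivative \<tau> *\<^sub>R iter_deriv F [h] (X s)) (at s)"
    by (rule bounded_linear.has_vector_derivative[OF bounded_linear_scaleR_right f0])
  from has_vector_derivative_diff[OF has_vector_derivative_add[OF mv[of A] this] has_vector_derivative_const[of y]]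
  have g: "(g has_vector_derivative u s) (at s)"
    by (simp add: g_def[abs_def] u_def)
  have "((\<lambda>s. \<tau> *\<^sub>R iter_deriv F [h] (X s)) has_vector_derivative \<tau> *\<^sub>R iter_deriv F [h, h] (X s)) (at s)"
    by (rule bounded_linear.has_vector_derivative[OF bounded_linear_scaleR_right f1])
  from has_vector_derivative_add[OF has_vector_derivative_const[of "A *v h"] this]
  have u: "(u has_vector_derivative \<tau> *\<^sub>R iter_deriv F [h, h] (X s)) (at s)"
    by (simp add: u_def[abs_def])
  have w: "((\<lambda>s. L *v (X s - m0)) has_vector_derivative L *v h) (at s)"
    unfolding matrix_vector_mult_diff_distrib
    using has_vector_derivative_diff[OF mv[of L] has_vector_derivative_const[of "L *v m0"]] by simp
  show "((\<lambda>s. \<Phi> (X s)) has_real_derivative iter_deriv \<Phi> [h] (X s)) (at s)"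
    unfolding neg_log_posterior_inner iter_deriv_neg_log_posterior_1 g_def[symmetric] u_def[symmetric]
    by (rule DERIV_cong[OF DERIV_add[OF DERIV_add[OF
          DERIV_cmult[OF has_real_derivative_inner[OF g g], of "1/2"]
          DERIV_cmult[OF has_real_derivative_inner[OF w w], of "\<epsilon>/2"]] DERIV_const[of c]]])
       (simp add: inner_commute)
  have wh: "((\<lambda>s. (L *v h) \<bullet> (L *v (X s - m0))) has_real_derivative ((L *v h) \<bullet> (L *v h))) (at s)"
    using has_real_derivative_inner[OF has_vector_derivative_const w, of "L *v h"] by simp
  show "((\<lambda>s. iter_deriv \<Phi> [h] (X s)) has_real_derivative iter_deriv \<Phi> [h, h] (X s)) (at s)"
    unfolding iter_deriv_neg_log_posterior_1 iter_deriv_neg_log_posterior_2 g_def[symmetric] u_def[symmetric]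
    by (rule DERIV_cong[OF DERIV_add[OF has_real_derivative_inner[OF u g] DERIV_cmult[OF wh, of \<epsilon>]]]) simp
  show "((\<lambda>s. iter_deriv \<Phi> [h, h] (X s)) has_real_derivative
          3 * \<tau> * ((A *v h + \<tau> *\<^sub>R iter_deriv F [h] (X s)) \<bullet> iter_deriv F [h, h] (X s))
          + \<tau> * (iter_deriv F [h, h, h] (X s) \<bullet> (A *v X s + \<tau> *\<^sub>R F (X s) - y))) (at s)"
    unfolding iter_deriv_neg_log_posterior_2 g_def[symmetric] u_def[symmetric] inner_scaleR_left
    by (rule DERIV_cong[OF DERIV_add[OF DERIV_add[OF has_real_derivative_inner[OF u u]
          DERIV_cmult[OF has_real_derivative_inner[OF f2 g], of \<tau>]] DERIV_const[of "\<epsilon> * ((L *v h) \<bullet> (L *v h))"]]])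
       (simp add: inner_commute algebra_simps)
qed

end

section \<open>Taylor remainder at the minimiser\<close>

lemma op_norm_le: "norm (A *v x) \<le> op_norm A * norm x"
  unfolding op_norm_def by (rule onorm) simp

lemma op_norm_nonneg: "0 \<le> op_norm A"
  unfolding op_norm_def by (rule onorm_pos_le) simp

text \<open>A vector of weighted norm at most 1 is the image under \<open>matrix_sqrt S\<close> of a
  Euclidean vector of norm at most 1. This is how the operator norm in \<open>V\<close>
  arises.\<close>

lemma op_norm_mult_sqrt_le:
  assumes "sym_pos_def S" "weighted_norm S h \<le> 1"
  shows "norm (A *v h) \<le> op_norm (A ** matrix_sqrt S)"
proof -
  have "A *v h = (A ** matrix_sqrt S) *v (matrix_inv (matrix_sqrt S) *v h)"
    by (simp add: matrix_vector_mul_assoc[symmetric] sym_pos_def_mult_inv[OF matrix_sqrt_works(1)[OF assms(1)]])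
  also have "norm \<dots> \<le> op_norm (A ** matrix_sqrt S) * weighted_norm S h"
    unfolding weighted_norm_def by (rule op_norm_le)
  also have "\<dots> \<le> op_norm (A ** matrix_sqrt S) * 1"
    using assms(2) op_norm_nonneg by (intro mult_left_mono)
  finally show ?thesis by simp
qed

text \<open>The squared length of the root applied to \<open>x\<close> is the quadratic form of
  \<open>S\<close>, whose size the entries of \<open>S\<close> control; the squared dimension counts
  these entries. It turns a bound on the covariance into one that is uniform in \<tau>.\<close>

lemma op_norm_mult_sqrt_bound:
  fixes A S :: "real^'n^'n"
  assumes "sym_pos_def S" "norm S \<le> R"
  shows "op_norm (A ** matrix_sqrt S) \<le> op_norm A * sqrt ((real CARD('n))\<^sup>2 * R)"
  unfolding op_norm_def[of "A ** matrix_sqrt S"]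
proof (rule onorm_le)
  fix x
  let ?R = "matrix_sqrt S"
  have comp: "\<bar>S $ i $ j\<bar> \<le> R" for i j
    using Finite_Cartesian_Product.norm_nth_le[of "S $ i" j] Finite_Cartesian_Product.norm_nth_le[of S i] assms(2) by simp
  have "(norm (?R *v x))\<^sup>2 = x \<bullet> (S *v x)"
    using sym_pos_def_inner[OF matrix_sqrt_works(1)[OF assms(1)]] matrix_sqrt_works(2)[OF assms(1)]
    by (simp add: power2_norm_eq_inner matrix_vector_mul_assoc)
  also have "\<dots> \<le> norm x * norm (S *v x)" by (rule norm_cauchy_schwarz)
  also have "\<dots> \<le> norm x * (onorm ((*v) S) * norm x)"
    by (intro mult_left_mono onorm) auto
  also have "\<dots> \<le> norm x * ((real CARD('n) * real CARD('n) * R) * norm x)"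
    by (intro mult_left_mono mult_right_mono onorm_le_matrix_component comp) auto
  finally have "(norm (?R *v x))\<^sup>2 \<le> ((real CARD('n))\<^sup>2 * R) * (norm x)\<^sup>2"
    by (simp add: power2_eq_square mult_ac)
  then have "norm (?R *v x) \<le> sqrt ((real CARD('n))\<^sup>2 * R) * norm x"
    by (metis norm_ge_zero real_le_rsqrt real_sqrt_abs real_sqrt_mult abs_norm_cancel)
  then have "op_norm A * norm (?R *v x) \<le> op_norm A * (sqrt ((real CARD('n))\<^sup>2 * R) * norm x)"
    by (intro mult_left_mono op_norm_nonneg)
  then show "norm (A ** ?R *v x) \<le> op_norm A * sqrt ((real CARD('n))\<^sup>2 * R) * norm x"
    using op_norm_le[of A "?R *v x"] by (simp add: matrix_vector_mul_assoc[symmetric] mult.assoc)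
qed

lemma Taylor_cubic_remainder:
  fixes \<phi> :: "real \<Rightarrow> real"
  assumes d: "\<And>s. (\<phi> has_real_derivative \<phi>1 s) (at s)" "\<And>s. (\<phi>1 has_real_derivative \<phi>2 s) (at s)"
    "\<And>s. (\<phi>2 has_real_derivative \<phi>3 s) (at s)"
    and r: "r > 0" and K: "\<And>s. \<bar>\<phi>3 s\<bar> \<le> K"
  shows "\<bar>\<phi> r - (\<phi> 0 + \<phi>1 0 * r + \<phi>2 0 / 2 * r\<^sup>2)\<bar> \<le> K / 6 * r ^ 3"
proof -
  define diff where "diff m = (if m = 0 then \<phi> else if m = 1 then \<phi>1 else if m = 2 then \<phi>2 else \<phi>3)" for m :: nat
  have "\<exists>t. 0 < t \<and> t < r \<and> \<phi> r = (\<Sum>m<3. diff m 0 / fact m * r ^ m) + diff 3 t / fact 3 * r ^ 3"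
  proof (rule Maclaurin[OF r])
    show "\<forall>m t. m < 3 \<and> 0 \<le> t \<and> t \<le> r \<longrightarrow> (diff m has_real_derivative diff (Suc m) t) (at t)"
    proof (intro allI impI)
      fix m :: nat and t assume "m < 3 \<and> 0 \<le> t \<and> t \<le> r"
      then consider "m = 0" | "m = 1" | "m = 2" by linarith
      then show "(diff m has_real_derivative diff (Suc m) t) (at t)"
        by cases (simp_all add: diff_def d)
    qed
  qed (simp_all add: diff_def)
  then obtain t where "\<phi> r = (\<Sum>m<3. diff m 0 / fact m * r ^ m) + diff 3 t / fact 3 * r ^ 3" by blast
  then have "\<phi> r - (\<phi> 0 + \<phi>1 0 * r + \<phi>2 0 / 2 * r\<^sup>2) = \<phi>3 t / 6 * r ^ 3"
    by (simp add: diff_def eval_nat_numeral)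
  also have "\<bar>\<dots>\<bar> = \<bar>\<phi>3 t\<bar> / 6 * r ^ 3" using r by (simp add: abs_mult)
  also have "\<dots> \<le> K / 6 * r ^ 3" using K[of t] r by (intro mult_right_mono divide_right_mono) auto
  finally show ?thesis .
qed

lemma inner_le_of_norm_le:
  assumes "norm a \<le> \<alpha>" "norm b \<le> \<beta>" shows "\<bar>a \<bullet> b\<bar> \<le> \<alpha> * \<beta>"
proof -
  have "\<bar>a \<bullet> b\<bar> \<le> norm a * norm b" by (rule Cauchy_Schwarz_ineq2)
  also have "\<dots> \<le> \<alpha> * \<beta>" using assms order_trans[OF norm_ge_zero assms(1)] by (intro mult_mono) auto
  finally show ?thesis .
qed

text \<open>In the application \<open>p\<close> is the linear residual at the minimiser,
  \<open>q\<close> and \<open>l\<close> are the images of the direction, \<open>w\<close> is the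
  prior residual, \<open>F0\<close>, \<open>F1\<close>, \<open>F2\<close> are value and derivatives
  of F at the minimiser, and \<open>Fr\<close> is its value at distance \<open>r\<close>. The
  equations say that the objective has value 0, slope 0 and curvature 1 there. Subtracting
  \<open>eq0\<close>, \<open>r\<close> times \<open>eq1\<close> and \<open>r\<^sup>2 / 2\<close>
  times \<open>eq2\<close> cancels every term free of \<open>\<tau>\<close>.\<close>

lemma quadratic_remainder_bound:
  fixes p q F0 F1 F2 Fr w l :: "'a::real_inner"
  assumes le: "norm p \<le> b" "norm q \<le> a" "norm F0 \<le> C0" "norm Fr \<le> C0" "norm F1 \<le> C1" "norm F2 \<le> C2"
    and r: "r \<ge> 1" and \<tau>: "0 \<le> \<tau>" "\<tau> \<le> 1"
    and eq0: "1/2 * ((p + \<tau> *\<^sub>R F0) \<bullet> (p + \<tau> *\<^sub>R F0)) + \<epsilon>/2 * (w \<bullet> w) + c = 0"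
    and eq1: "(q + \<tau> *\<^sub>R F1) \<bullet> (p + \<tau> *\<^sub>R F0) + \<epsilon> * (l \<bullet> w) = 0"
    and eq2: "(q + \<tau> *\<^sub>R F1) \<bullet> (q + \<tau> *\<^sub>R F1) + (\<tau> *\<^sub>R F2) \<bullet> (p + \<tau> *\<^sub>R F0) + \<epsilon> * (l \<bullet> l) = 1"
  shows "\<bar>1/2 * ((p + r *\<^sub>R q + \<tau> *\<^sub>R Fr) \<bullet> (p + r *\<^sub>R q + \<tau> *\<^sub>R Fr)) + \<epsilon>/2 * ((w + r *\<^sub>R l) \<bullet> (w + r *\<^sub>R l)) + c - r\<^sup>2 / 2\<bar>
    \<le> \<tau> * (2 * b * C0 + 2 * a * C0 + b * C1 + a * C1 + b * C2 + C0 * C0 + C0 * C1 + C1 * C1 + C2 * C0) * r\<^sup>2"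
    (is "\<bar>?lhs\<bar> \<le> _")
proof -
  have nn: "0 \<le> b" "0 \<le> a" "0 \<le> C0" "0 \<le> C1" "0 \<le> C2"
    using le(1,2,3,5,6) order_trans[OF norm_ge_zero] by blast+
  define E1 where "E1 = p \<bullet> Fr + r * (q \<bullet> Fr) - p \<bullet> F0 - r * (q \<bullet> F0) - r * (F1 \<bullet> p) - r\<^sup>2 * (q \<bullet> F1) - r\<^sup>2 * (1/2 * (F2 \<bullet> p))"
  define E2 where "E2 = 1/2 * (Fr \<bullet> Fr) - 1/2 * (F0 \<bullet> F0) - r * (F1 \<bullet> F0) - r\<^sup>2 * (1/2 * (F1 \<bullet> F1)) - r\<^sup>2 * (1/2 * (F2 \<bullet> F0))"
  have "?lhs = ?lhs - (1/2 * ((p + \<tau> *\<^sub>R F0) \<bullet> (p + \<tau> *\<^sub>R F0)) + \<epsilon>/2 * (w \<bullet> w) + c)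
     - r * ((q + \<tau> *\<^sub>R F1) \<bullet> (p + \<tau> *\<^sub>R F0) + \<epsilon> * (l \<bullet> w))
     - r\<^sup>2 / 2 * ((q + \<tau> *\<^sub>R F1) \<bullet> (q + \<tau> *\<^sub>R F1) + (\<tau> *\<^sub>R F2) \<bullet> (p + \<tau> *\<^sub>R F0) + \<epsilon> * (l \<bullet> l)) + r\<^sup>2 / 2"
    unfolding eq0 eq1 eq2 by simp
  also have "\<dots> = \<tau> * E1 + \<tau>\<^sup>2 * E2"
    unfolding E1_def E2_def
    by (simp add: inner_add_left inner_add_right inner_commute power2_eq_square field_simps)
  finally have lhs: "?lhs = \<tau> * E1 + \<tau>\<^sup>2 * E2" .
  have r2: "1 \<le> r\<^sup>2" "r \<le> r\<^sup>2" using r power_increasing[of 1 2 r] by simp_all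
  have up: "\<bar>k * (u \<bullet> v)\<bar> \<le> \<alpha> * \<beta> * r\<^sup>2"
    if "norm u \<le> \<alpha>" "norm v \<le> \<beta>" "0 \<le> k" "k \<le> r\<^sup>2" for k \<alpha> \<beta> and u v :: 'a
  proof -
    have "\<bar>k * (u \<bullet> v)\<bar> = k * \<bar>u \<bullet> v\<bar>" using that by (simp add: abs_mult)
    also have "\<dots> \<le> r\<^sup>2 * (\<alpha> * \<beta>)"
      using that inner_le_of_norm_le[OF that(1,2)] by (intro mult_mono) auto
    finally show ?thesis by (simp add: mult_ac)
  qed
  have t: "\<bar>1 * (p \<bullet> Fr)\<bar> \<le> b * C0 * r\<^sup>2" "\<bar>r * (q \<bullet> Fr)\<bar> \<le> a * C0 * r\<^sup>2" "\<bar>1 * (p \<bullet> F0)\<bar> \<le> b * C0 * r\<^sup>2"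
    "\<bar>r * (q \<bullet> F0)\<bar> \<le> a * C0 * r\<^sup>2" "\<bar>r * (F1 \<bullet> p)\<bar> \<le> C1 * b * r\<^sup>2" "\<bar>r\<^sup>2 * (q \<bullet> F1)\<bar> \<le> a * C1 * r\<^sup>2"
    "\<bar>r\<^sup>2 * (F2 \<bullet> p)\<bar> \<le> C2 * b * r\<^sup>2"
    "\<bar>1 * (Fr \<bullet> Fr)\<bar> \<le> C0 * C0 * r\<^sup>2" "\<bar>1 * (F0 \<bullet> F0)\<bar> \<le> C0 * C0 * r\<^sup>2" "\<bar>r * (F1 \<bullet> F0)\<bar> \<le> C1 * C0 * r\<^sup>2"
    "\<bar>r\<^sup>2 * (F1 \<bullet> F1)\<bar> \<le> C1 * C1 * r\<^sup>2" "\<bar>r\<^sup>2 * (F2 \<bullet> F0)\<bar> \<le> C2 * C0 * r\<^sup>2"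
    by (rule up; use le r r2 in simp)+
  \<comment> \<open>\<open>B1\<close> and \<open>B2\<close> collect the coefficients of the
    estimates in \<open>t\<close>; single terms with coefficient 1/2 are counted in full.\<close>
  define B1 where "B1 = 2 * b * C0 + 2 * a * C0 + b * C1 + a * C1 + b * C2"
  define B2 where "B2 = C0 * C0 + C0 * C1 + C1 * C1 + C2 * C0"
  have "0 \<le> b * C2 * r\<^sup>2" "0 \<le> C1 * C1 * r\<^sup>2" "0 \<le> C2 * C0 * r\<^sup>2" "0 \<le> B2"
    using nn by (simp_all add: B2_def)
  note nn2 = this
  have E1: "\<bar>E1\<bar> \<le> B1 * r\<^sup>2"
    using t(1-7) nn2 unfolding E1_def B1_def by (simp add: algebra_simps)
  have E2: "\<bar>E2\<bar> \<le> B2 * r\<^sup>2"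
  proof -
    have "B2 * r\<^sup>2 = C0 * C0 * r\<^sup>2 + C1 * C0 * r\<^sup>2 + C1 * C1 * r\<^sup>2 + C2 * C0 * r\<^sup>2"
      by (simp add: B2_def algebra_simps)
    then show ?thesis
      using t(8-12) nn2 inner_ge_zero[of Fr] inner_ge_zero[of F0]
        mult_nonneg_nonneg[OF zero_le_power2[of r] inner_ge_zero[of F1]]
      unfolding E2_def by linarith
  qed
  have "\<bar>\<tau> * E1 + \<tau>\<^sup>2 * E2\<bar> \<le> \<tau> * \<bar>E1\<bar> + \<tau>\<^sup>2 * \<bar>E2\<bar>"
    using \<tau> by (intro order_trans[OF abs_triangle_ineq]) (simp add: abs_mult)
  also have "\<dots> \<le> \<tau> * (B1 * r\<^sup>2) + \<tau> * (B2 * r\<^sup>2)"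
    using \<tau> E1 E2 nn2 by (intro add_mono mult_mono) (auto simp: power2_eq_square mult_left_le)
  finally show ?thesis unfolding lhs by (simp add: B1_def B2_def algebra_simps)
qed

text \<open>On the ray through \<open>x\<close>, with direction of unit weighted length, the Taylor
  polynomial at the minimiser is exactly \<open>r\<^sup>2 / 2\<close>, because \<open>S\<close> is
  the inverse Hessian. Both estimates bound the same deviation: one by the third derivative, the
  other by the exact cancellation of the quadratic part.\<close>

lemma laplace_remainder:
  fixes \<epsilon> \<tau> c :: real and A S0 :: "real^'n^'n" and F :: "real^'n \<Rightarrow> real^'n" and m0 y xh x :: "real^'n"
  defines "\<Phi> \<equiv> neg_log_posterior \<epsilon> A F m0 S0 y c \<tau>"
  defines "S \<equiv> matrix_inv (hessian \<Phi> xh)"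
  defines "r \<equiv> weighted_norm S (x - xh)" and "a \<equiv> op_norm (A ** matrix_sqrt S)" and "b \<equiv> norm (A *v xh - y)"
  assumes F: "C_class 3 F" and \<tau>: "0 \<le> \<tau>"
    and min: "\<Phi> xh = 0" "\<And>z. \<Phi> z \<ge> 0" and H: "sym_pos_def (hessian \<Phi> xh)"
    and C: "\<And>z. deriv_norm 0 F S z \<le> C0" "\<And>z. deriv_norm 1 F S z \<le> C1" "\<And>z. deriv_norm 2 F S z \<le> C2"
      "\<And>z. deriv_norm 3 F S z \<le> C3"
    and M: "M \<ge> 0" and D3F: "\<And>z h1 h2 h3. z \<notin> cball 0 M \<Longrightarrow> iter_deriv F [h1, h2, h3] z = 0"
  shows "\<bar>\<Phi> x - r\<^sup>2 / 2\<bar> \<le> (\<tau> * (C3 * (op_norm A * M + norm y) + 3 * C2 * a) + \<tau>\<^sup>2 * (C3 * C0 + 3 * C2 * C1)) / 6 * r ^ 3"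
    and "\<tau> \<le> 1 \<Longrightarrow> r \<ge> 1 \<Longrightarrow> \<bar>\<Phi> x - r\<^sup>2 / 2\<bar> \<le>
      \<tau> * (2 * b * C0 + 2 * a * C0 + b * C1 + a * C1 + b * C2 + C0 * C0 + C0 * C1 + C1 * C1 + C2 * C0) * r\<^sup>2"
proof -
  have S: "sym_pos_def S" unfolding S_def by (rule sym_pos_def_matrix_inv[OF H])
  have invS: "matrix_inv S = hessian \<Phi> xh"
    unfolding S_def by (rule matrix_inv_matrix_inv[OF sym_pos_def_invertible[OF H]])
  let ?K = "\<tau> * (C3 * (op_norm A * M + norm y) + 3 * C2 * a) + \<tau>\<^sup>2 * (C3 * C0 + 3 * C2 * C1)"
  let ?B = "2 * b * C0 + 2 * a * C0 + b * C1 + a * C1 + b * C2 + C0 * C0 + C0 * C1 + C1 * C1 + C2 * C0"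
  have "\<bar>\<Phi> x - r\<^sup>2 / 2\<bar> \<le> ?K / 6 * r ^ 3 \<and> (\<tau> \<le> 1 \<longrightarrow> r \<ge> 1 \<longrightarrow> \<bar>\<Phi> x - r\<^sup>2 / 2\<bar> \<le> \<tau> * ?B * r\<^sup>2)"
  proof (cases "x = xh")
    case True
    then have "r = 0" by (simp add: r_def weighted_norm_def)
    then show ?thesis using True min by simp
  next
    case False
    have "r \<ge> 0" by (simp add: r_def weighted_norm_def)
    moreover have "r \<noteq> 0"
    proof
      assume "r = 0"
      then have "(x - xh) \<bullet> (hessian \<Phi> xh *v (x - xh)) = 0"
        using weighted_norm_sq[OF S, of "x - xh"] by (simp add: r_def invS)
      moreover have "0 < (x - xh) \<bullet> (hessian \<Phi> xh *v (x - xh))"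
        using H False by (simp add: sym_pos_def_def)
      ultimately show False by simp
    qed
    ultimately have r: "r > 0" by simp
    define h where "h = (1 / r) *\<^sub>R (x - xh)"
    have x: "x = xh + r *\<^sub>R h" using r by (simp add: h_def)
    have wh: "weighted_norm S h = 1"
      using r unfolding h_def r_def weighted_norm_def by (simp add: matrix_vector_mult_scaleR)
    define X where "X s = xh + s *\<^sub>R h" for s
    have X0: "X 0 = xh" "X r = x" by (simp_all add: X_def x)
    note d = neg_log_posterior_line_derivs[OF F, where \<epsilon>=\<epsilon> and A=A and ?m0.0=m0 and ?S0.0=S0 and y=y and c=c and \<tau>=\<tau> and x=xh and h=h, folded \<Phi>_def X_def]
    have C1F: "C_class 0 F" "C_class 1 F" "C_class 2 F"
      by (rule C_class_mono[OF _ F]; simp)+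
    have f0: "norm (F z) \<le> C0" for z
      using order_trans[OF iter_deriv_le_deriv_norm[OF S C1F(1), of "[]" z] C(1)] by simp
    have f1: "norm (iter_deriv F [h] z) \<le> C1" for z
      using order_trans[OF iter_deriv_le_deriv_norm[OF S C1F(2), of "[h]" z] C(2)] wh by simp
    have f2: "norm (iter_deriv F [h, h] z) \<le> C2" for z
      using order_trans[OF iter_deriv_le_deriv_norm[OF S C1F(3), of "[h, h]" z] C(3)] wh by simp
    have f3: "norm (iter_deriv F [h, h, h] z) \<le> C3" for z
      using order_trans[OF iter_deriv_le_deriv_norm[OF S F, of "[h, h, h]" z] C(4)] wh by simp
    have Ah: "norm (A *v h) \<le> a" unfolding a_def using wh by (intro op_norm_mult_sqrt_le[OF S]) simp
    have \<phi>1: "iter_deriv \<Phi> [h] xh = 0"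
    proof -
      have "((\<lambda>s. \<Phi> (X s)) has_real_derivative iter_deriv \<Phi> [h] (X 0)) (at 0)" by (rule d(1))
      then have "iter_deriv \<Phi> [h] (X 0) = 0"
        by (rule DERIV_local_min[where d=1]) (use min X0 in auto)
      then show ?thesis by (simp add: X0)
    qed
    have \<phi>2: "iter_deriv \<Phi> [h, h] xh = 1"
      using weighted_norm_sq[OF S, of h] hessian_neg_log_posterior[OF F, where \<epsilon>=\<epsilon> and A=A and ?m0.0=m0 and ?S0.0=S0 and y=y and c=c and \<tau>=\<tau> and v=h and x=xh] wh
      by (simp add: invS \<Phi>_def)
    have "\<bar>\<Phi> (X r) - (\<Phi> (X 0) + iter_deriv \<Phi> [h] (X 0) * r + iter_deriv \<Phi> [h, h] (X 0) / 2 * r\<^sup>2)\<bar> \<le> ?K / 6 * r ^ 3"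
    proof (rule Taylor_cubic_remainder[OF d(1) d(2) d(3) r])
      fix s
      let ?u = "A *v h + \<tau> *\<^sub>R iter_deriv F [h] (X s)" and ?g = "A *v X s + \<tau> *\<^sub>R F (X s) - y"
      have C0p: "0 \<le> C0" "0 \<le> C3" using f0[of 0] f3[of 0] order_trans[OF norm_ge_zero] by blast+
      have "norm ?u \<le> a + \<tau> * C1"
        using Ah f1[of "X s"] \<tau> by (intro order_trans[OF norm_triangle_ineq] add_mono) (auto intro: mult_left_mono)
      then have 1: "\<bar>?u \<bullet> iter_deriv F [h, h] (X s)\<bar> \<le> (a + \<tau> * C1) * C2"
        using f2 by (rule inner_le_of_norm_le)
      \<comment> \<open>The residual is unbounded along the ray, but it is multiplied by the third
        derivative of F, which vanishes outside the ball. Inside, the position has norm at most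
        \<open>M\<close>; this gives the term with \<open>op_norm A * M\<close> in
        \<open>V\<close>.\<close>
      have 2: "\<bar>iter_deriv F [h, h, h] (X s) \<bullet> ?g\<bar> \<le> C3 * (op_norm A * M + \<tau> * C0 + norm y)"
      proof (cases "X s \<in> cball 0 M")
        case True
        have "norm (A *v X s) \<le> op_norm A * M"
          using True op_norm_le[of A "X s"] mult_left_mono[of "norm (X s)" M "op_norm A"] op_norm_nonneg[of A] by auto
        moreover have "norm (\<tau> *\<^sub>R F (X s)) \<le> \<tau> * C0"
          using \<tau> f0 by (auto intro: mult_left_mono)
        ultimately have "norm ?g \<le> op_norm A * M + \<tau> * C0 + norm y"
          using norm_triangle_ineq4[of "A *v X s + \<tau> *\<^sub>R F (X s)" y] norm_triangle_ineq[of "A *v X s" "\<tau> *\<^sub>R F (X s)"] by linarith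
        with f3 show ?thesis by (rule inner_le_of_norm_le)
      next
        case False
        then have "iter_deriv F [h, h, h] (X s) = 0" by (rule D3F)
        then show ?thesis using C0p \<tau> M op_norm_nonneg[of A] by simp
      qed
      have "\<bar>3 * \<tau> * (?u \<bullet> iter_deriv F [h, h] (X s)) + \<tau> * (iter_deriv F [h, h, h] (X s) \<bullet> ?g)\<bar>
        \<le> 3 * \<tau> * \<bar>?u \<bullet> iter_deriv F [h, h] (X s)\<bar> + \<tau> * \<bar>iter_deriv F [h, h, h] (X s) \<bullet> ?g\<bar>"
        using \<tau> by (intro order_trans[OF abs_triangle_ineq]) (simp add: abs_mult)
      also have "\<dots> \<le> 3 * \<tau> * ((a + \<tau> * C1) * C2) + \<tau> * (C3 * (op_norm A * M + \<tau> * C0 + norm y))"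
        using \<tau> 1 2 by (intro add_mono mult_left_mono) auto
      \<comment> \<open>The contributions of \<open>\<tau> * C1\<close> and
        \<open>\<tau> * C0\<close> inside the brackets form the second-order coefficient, which is
        \<open>W\<close>.\<close>
      also have "\<dots> = ?K" by (simp add: power2_eq_square algebra_simps)
      finally show "\<bar>3 * \<tau> * (?u \<bullet> iter_deriv F [h, h] (X s)) + \<tau> * (iter_deriv F [h, h, h] (X s) \<bullet> ?g)\<bar> \<le> ?K" .
    qed
    then have "\<bar>\<Phi> x - r\<^sup>2 / 2\<bar> \<le> ?K / 6 * r ^ 3"
      by (simp add: X0 min \<phi>1 \<phi>2)
    moreover have "\<bar>\<Phi> x - r\<^sup>2 / 2\<bar> \<le> \<tau> * ?B * r\<^sup>2" if "\<tau> \<le> 1" "r \<ge> 1"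
    proof -
      let ?L = "matrix_inv (matrix_sqrt S0)"
      note nl = neg_log_posterior_inner[OF F, where \<epsilon>=\<epsilon> and A=A and ?m0.0=m0 and ?S0.0=S0 and y=y and c=c and \<tau>=\<tau>, folded \<Phi>_def]
      note nl1 = iter_deriv_neg_log_posterior_1[OF F, where \<epsilon>=\<epsilon> and A=A and ?m0.0=m0 and ?S0.0=S0 and y=y and c=c and \<tau>=\<tau>, folded \<Phi>_def]
      note nl2 = iter_deriv_neg_log_posterior_2[OF F, where \<epsilon>=\<epsilon> and A=A and ?m0.0=m0 and ?S0.0=S0 and y=y and c=c and \<tau>=\<tau>, folded \<Phi>_def]
      have swap: "A *v xh + \<tau> *\<^sub>R F z - y = (A *v xh - y) + \<tau> *\<^sub>R F z" for z by simp
      have "\<Phi> x = 1/2 * (((A *v xh - y) + r *\<^sub>R (A *v h) + \<tau> *\<^sub>R F x) \<bullet> ((A *v xh - y) + r *\<^sub>R (A *v h) + \<tau> *\<^sub>R F x))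
         + \<epsilon>/2 * ((?L *v (xh - m0) + r *\<^sub>R (?L *v h)) \<bullet> (?L *v (xh - m0) + r *\<^sub>R (?L *v h))) + c"
      proof -
        have e1: "A *v x + \<tau> *\<^sub>R F x - y = (A *v xh - y) + r *\<^sub>R (A *v h) + \<tau> *\<^sub>R F x"
          by (subst (1) x) (simp add: matrix_vector_right_distrib matrix_vector_mult_scaleR)
        have e2: "?L *v (x - m0) = ?L *v (xh - m0) + r *\<^sub>R (?L *v h)"
          by (subst x) (simp add: matrix_vector_right_distrib matrix_vector_mult_diff_distrib matrix_vector_mult_scaleR)
        show ?thesis unfolding nl e1 e2 by (rule refl)
      qed
      moreover note quadratic_remainder_bound[where p="A *v xh - y" and q="A *v h" and ?F0.0="F xh" and Fr="F x"
          and ?F1.0="iter_deriv F [h] xh" and ?F2.0="iter_deriv F [h, h] xh" and w="?L *v (xh - m0)" and l="?L *v h"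
          and b=b and a=a and ?C0.0=C0 and ?C1.0=C1 and ?C2.0=C2 and r=r and \<tau>=\<tau> and \<epsilon>=\<epsilon> and c=c,
          OF _ Ah f0 f0 f1 f2 that(2) \<tau> that(1)]
      ultimately show ?thesis
        using min(1) \<phi>1 \<phi>2 unfolding nl[of xh] nl1 nl2 swap by (simp add: b_def)
    qed
    ultimately show ?thesis by blast
  qed
  then show "\<bar>\<Phi> x - r\<^sup>2 / 2\<bar> \<le> ?K / 6 * r ^ 3"
    and "\<tau> \<le> 1 \<Longrightarrow> r \<ge> 1 \<Longrightarrow> \<bar>\<Phi> x - r\<^sup>2 / 2\<bar> \<le> \<tau> * ?B * r\<^sup>2" by blast+
qed

section \<open>Uniform bounds for small \<tau>, and the conclusion\<close>

lemma eventually_norm_le_of_tendsto: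
  fixes f :: "'a \<Rightarrow> 'b::real_normed_vector"
  assumes "(f \<longlongrightarrow> l) F"
  shows "\<forall>\<^sub>F x in F. norm (f x) \<le> norm l + 1"
  using order_tendstoD(2)[OF tendsto_norm[OF assms], of "norm l + 1"]
  by (simp add: eventually_mono less_imp_le)

lemma neg_log_posterior_measurable:
  assumes "C_class 3 F"
  shows "neg_log_posterior \<epsilon> A F m0 S0 y c \<tau> \<in> borel_measurable borel"
  using has_derivative_continuous[OF neg_log_posterior_has_derivative[OF assms]]
  by (intro borel_measurable_continuous_onI continuous_at_imp_continuous_on) blast

theorem theorem5p3:
  fixes \<epsilon> :: real
    and A \<Sigma>0 :: "real^'n^'n"
    and F :: "real^'n \<Rightarrow> real^'n"
    and m0 :: "real^'n"
    and y :: "real \<Rightarrow> real^'n"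
    and c :: "real \<Rightarrow> real"
    and I :: "real \<Rightarrow> real^'n \<Rightarrow> real"
    and \<tau>0 :: real
    and xhat :: "real \<Rightarrow> real^'n"
    and \<Sigma> :: "real \<Rightarrow> real^'n^'n"
    and C0 C1 C2 C3 M :: real
    and C W :: real
    and V :: "real \<Rightarrow> real"
  defines "I \<equiv> \<lambda>\<tau>. neg_log_posterior \<epsilon> A F m0 \<Sigma>0 (y \<tau>) (c \<tau>) \<tau>"
    and "\<Sigma> \<equiv> \<lambda>\<tau>. matrix_inv (hessian (I \<tau>) (xhat \<tau>))"
    and "C \<equiv> 2/3 * sqrt 2 * exp 1 * Gamma (real CARD('n) / 2 + 3/2) / Gamma (real CARD('n) / 2)"
    and "V \<equiv> \<lambda>\<tau>. C3 * (op_norm A * M + norm (y \<tau>)) + 3 * C2 * op_norm (A ** matrix_sqrt (\<Sigma> \<tau>))"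
    and "W \<equiv> C3 * C0 + 3 * C2 * C1"
  assumes eps: "\<epsilon> > 0"
    and F_C3: "C_class 3 F"
    and Sigma0: "sym_pos_def \<Sigma>0"
    and c_min: "\<And>\<tau>. \<tau> \<ge> 0 \<Longrightarrow> (\<exists>x. I \<tau> x = 0) \<and> (\<forall>x. I \<tau> x \<ge> 0)"
    and tau0: "\<tau>0 > 0"
    and unique_min: "\<And>\<tau> x. \<tau> \<in> {0..\<tau>0} \<Longrightarrow> is_arg_min (I \<tau>) (\<lambda>_. True) x \<longleftrightarrow> x = xhat \<tau>"
    and hess_pos: "\<And>\<tau>. \<tau> \<in> {0..\<tau>0} \<Longrightarrow> sym_pos_def (hessian (I \<tau>) (xhat \<tau>))"
    and y_conv: "\<exists>y'. (y \<longlongrightarrow> y') (at_right 0)"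
    and xhat_conv: "\<exists>x'. (xhat \<longlongrightarrow> x') (at_right 0)"
    and Sigma_conv: "\<exists>S. (\<Sigma> \<longlongrightarrow> S) (at_right 0) \<and> sym_pos_def S"
    and const_pos: "C0 > 0" "C1 > 0" "C2 > 0" "C3 > 0"
    and F_bounds: "\<And>\<tau> x. \<tau> \<in> {0..\<tau>0} \<Longrightarrow>
          deriv_norm 0 F (\<Sigma> \<tau>) x \<le> C0 \<and> deriv_norm 1 F (\<Sigma> \<tau>) x \<le> C1 \<and>
          deriv_norm 2 F (\<Sigma> \<tau>) x \<le> C2 \<and> deriv_norm 3 F (\<Sigma> \<tau>) x \<le> C3"
    and M_pos: "M > 0"
    and D3F_zero: "\<And>x h1 h2 h3. x \<notin> cball 0 M \<Longrightarrow> iter_deriv F [h1, h2, h3] x = 0"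
  shows "\<exists>\<tau>1\<in>{0<..\<tau>0}.
           (\<forall>\<tau>\<in>{0..\<tau>1}.
              tv_dist (posterior \<epsilon> (I \<tau>)) (gaussian (xhat \<tau>) (\<epsilon> *\<^sub>R \<Sigma> \<tau>))
                \<le> C * (1 + \<epsilon>) * sqrt \<epsilon> * (V \<tau> * \<tau> + W/2 * \<tau>\<^sup>2)) \<and>
           bounded (V ` {0..\<tau>1})"
proof -
  define p where "p = real CARD('n) / 2"
  define \<delta> where "\<delta> = exp (- 1 / (p + 3/2))"
  \<comment> \<open>The share of the quadratic form that the remainder may consume.\<close>
  define \<eta> where "\<eta> = 1 - \<delta>"
  define a where "a \<tau> = op_norm (A ** matrix_sqrt (\<Sigma> \<tau>))" for \<tau>
  define b where "b \<tau> = norm (A *v xhat \<tau> - y \<tau>)" for \<tau>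
  define B where "B a b = 2 * b * C0 + 2 * a * C0 + b * C1 + a * C1 + b * C2 + C0 * C0 + C0 * C1 + C1 * C1 + C2 * C0"
    for a b
  have p: "p > 0" by (simp add: p_def)
  have \<delta>: "0 < \<delta>" "\<delta> \<le> 1" and \<eta>: "\<eta> > 0" using p by (simp_all add: \<delta>_def \<eta>_def)
  have \<delta>p: "\<delta> powr (p + 3/2) = exp (- 1)" using p by (simp add: \<delta>_def powr_def)
  have a0: "0 \<le> a \<tau>" and b0: "0 \<le> b \<tau>" for \<tau> by (simp_all add: a_def b_def op_norm_nonneg)
  have W0: "W > 0" using const_pos by (simp add: W_def add_pos_pos)
  have V0: "0 \<le> V \<tau>" for \<tau>
    using const_pos M_pos a0[of \<tau>] op_norm_nonneg[of A] by (simp add: V_def a_def)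
  have \<Sigma>: "sym_pos_def (\<Sigma> \<tau>)" if "\<tau> \<in> {0..\<tau>0}" for \<tau>
    unfolding \<Sigma>_def by (rule sym_pos_def_matrix_inv[OF hess_pos[OF that]])
  obtain Y X R where YX: "(y \<longlongrightarrow> Y) (at_right 0)" "(xhat \<longlongrightarrow> X) (at_right 0)" "(\<Sigma> \<longlongrightarrow> R) (at_right 0)"
    using y_conv xhat_conv Sigma_conv by blast
  have "((\<lambda>\<tau>. A *v xhat \<tau> - y \<tau>) \<longlongrightarrow> A *v X - Y) (at_right 0)"
    by (intro tendsto_diff YX bounded_linear.tendsto[OF _ YX(2)]) simp
  \<comment> \<open>The limits are one-sided, so these bounds hold for positive \<tau> only; \<tau>
    = 0 is treated apart wherever they are used.\<close>
  from eventually_conj[OF eventually_norm_le_of_tendsto[OF this] eventually_conj[OF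
      eventually_norm_le_of_tendsto[OF YX(1)] eventually_norm_le_of_tendsto[OF YX(3)]]]
  obtain t where t: "t > 0" and ev: "\<And>\<tau>. 0 < \<tau> \<Longrightarrow> \<tau> < t \<Longrightarrow> b \<tau> \<le> norm (A *v X - Y) + 1 \<and>
      norm (y \<tau>) \<le> norm Y + 1 \<and> norm (\<Sigma> \<tau>) \<le> norm R + 1"
    unfolding eventually_at_right_field b_def by blast
  define \<beta> where "\<beta> = norm (A *v X - Y) + 1"
  define \<alpha> where "\<alpha> = op_norm A * sqrt ((real CARD('n))\<^sup>2 * (norm R + 1))"
  define Vm where "Vm = C3 * (op_norm A * M + (norm Y + 1)) + 3 * C2 * \<alpha>"
  have \<alpha>0: "\<alpha> \<ge> 0" "\<beta> \<ge> 0" by (simp_all add: \<alpha>_def \<beta>_def op_norm_nonneg)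
  have Vm0: "Vm \<ge> 0" using const_pos M_pos \<alpha>0 op_norm_nonneg[of A] by (simp add: Vm_def)
  have BB0: "B \<alpha> \<beta> \<ge> 0" using const_pos \<alpha>0 by (simp add: B_def)
  have e: "0 < 3 * \<eta> / (Vm + W)" "0 < \<eta> / (2 * (B \<alpha> \<beta> + 1))"
    using \<eta> Vm0 W0 BB0 by simp_all
  \<comment> \<open>The bound 1 gives \<tau>^2 at most \<tau>, and \<open>t / 2\<close> keeps \<tau>
    strictly below \<open>t\<close>. The last two terms hold the cubic and the quadratic error below
    \<open>\<eta> / 2\<close> times r^2, for r below 1 and r at least 1 respectively; the summand 1
    keeps the denominator positive.\<close>
  define \<tau>1 where "\<tau>1 = min (min \<tau>0 1) (min (t / 2) (min (3 * \<eta> / (Vm + W)) (\<eta> / (2 * (B \<alpha> \<beta> + 1)))))"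
  have \<tau>1: "0 < \<tau>1" "\<tau>1 \<le> \<tau>0" "\<tau>1 \<le> 1" "\<tau>1 < t" "\<tau>1 \<le> 3 * \<eta> / (Vm + W)" "\<tau>1 \<le> \<eta> / (2 * (B \<alpha> \<beta> + 1))"
    unfolding \<tau>1_def using tau0 t e by (simp_all only: min_le_iff_disj min_less_iff_disj min_less_iff_conj) simp_all
  have pos: "a \<tau> \<le> \<alpha>" "b \<tau> \<le> \<beta>" "V \<tau> \<le> Vm" if "0 < \<tau>" "\<tau> \<le> \<tau>1" for \<tau>
  proof -
    have e: "b \<tau> \<le> \<beta>" "norm (y \<tau>) \<le> norm Y + 1" "norm (\<Sigma> \<tau>) \<le> norm R + 1"
      using ev[of \<tau>] that \<tau>1 by (auto simp: \<beta>_def)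
    show "a \<tau> \<le> \<alpha>" unfolding a_def \<alpha>_def using that \<tau>1
      by (intro op_norm_mult_sqrt_bound \<Sigma> e) auto
    then show "V \<tau> \<le> Vm" unfolding V_def Vm_def a_def[symmetric] using e const_pos
      by (intro add_mono mult_left_mono) (auto intro: op_norm_nonneg)
    show "b \<tau> \<le> \<beta>" by (rule e)
  qed
  define K where "K \<tau> = \<tau> * V \<tau> + \<tau>\<^sup>2 * W" for \<tau>
  have small: "0 \<le> K \<tau>" "K \<tau> \<le> 3 * \<eta>" "\<tau> * B (a \<tau>) (b \<tau>) \<le> \<eta> / 2" if "\<tau> \<in> {0..\<tau>1}" for \<tau>
  proof -
    show "0 \<le> K \<tau>" using that V0 W0 by (simp add: K_def)
    show "K \<tau> \<le> 3 * \<eta>"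
    proof (cases "\<tau> = 0")
      case False
      then have \<tau>: "0 < \<tau>" "\<tau> \<le> \<tau>1" using that by auto
      have "\<tau>\<^sup>2 * W \<le> \<tau> * W"
        using \<tau> \<tau>1 W0 by (intro mult_right_mono) (auto simp: power2_eq_square mult_left_le)
      moreover have "\<tau> * V \<tau> \<le> \<tau> * Vm" using pos(3)[OF \<tau>] \<tau> by (intro mult_left_mono) auto
      moreover have "\<tau> * (Vm + W) \<le> 3 * \<eta>"
      proof -
        have "\<tau> \<le> 3 * \<eta> / (Vm + W)" using \<tau> \<tau>1 by linarith
        then show ?thesis using Vm0 W0 by (simp add: pos_le_divide_eq)
      qed
      ultimately show ?thesis by (simp add: K_def algebra_simps)
    qed (use \<eta> in \<open>simp add: K_def\<close>)
    show "\<tau> * B (a \<tau>) (b \<tau>) \<le> \<eta> / 2"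
    proof (cases "\<tau> = 0")
      case False
      then have \<tau>: "0 < \<tau>" "\<tau> \<le> \<tau>1" using that by auto
      have "B (a \<tau>) (b \<tau>) \<le> B \<alpha> \<beta>"
        unfolding B_def using pos(1,2)[OF \<tau>] const_pos a0[of \<tau>] b0[of \<tau>] \<alpha>0 by (intro add_mono mult_mono mult_right_mono) auto
      then have "\<tau> * B (a \<tau>) (b \<tau>) \<le> \<tau> * (B \<alpha> \<beta> + 1)" using \<tau> by (intro mult_left_mono) auto
      also have "\<dots> \<le> \<eta> / 2"
      proof -
        have "\<tau> \<le> \<eta> / (2 * (B \<alpha> \<beta> + 1))" using \<tau> \<tau>1 by linarith
        then have "\<tau> * (2 * (B \<alpha> \<beta> + 1)) \<le> \<eta>" using BB0 by (subst (asm) pos_le_divide_eq) auto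
        then show ?thesis by (simp add: algebra_simps)
      qed
      finally show ?thesis .
    qed (use \<eta> in simp)
  qed
  have tv: "tv_dist (posterior \<epsilon> (I \<tau>)) (gaussian (xhat \<tau>) (\<epsilon> *\<^sub>R \<Sigma> \<tau>))
      \<le> C * (1 + \<epsilon>) * sqrt \<epsilon> * (V \<tau> * \<tau> + W/2 * \<tau>\<^sup>2)" if \<tau>: "\<tau> \<in> {0..\<tau>1}" for \<tau>
  proof -
    have \<tau>0: "\<tau> \<in> {0..\<tau>0}" "0 \<le> \<tau>" "\<tau> \<le> 1" using \<tau> \<tau>1 by auto
    have nonneg: "I \<tau> z \<ge> 0" for z using c_min[OF \<tau>0(2)] by blast
    \<comment> \<open>The constant \<open>c \<tau>\<close> makes 0 the attained minimum, and the
      minimiser attains it.\<close>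
    have zero: "I \<tau> (xhat \<tau>) = 0"
    proof -
      obtain z where "I \<tau> z = 0" using c_min[OF \<tau>0(2)] by blast
      moreover have "\<not> I \<tau> z < I \<tau> (xhat \<tau>)"
        using unique_min[OF \<tau>0(1), of "xhat \<tau>"] by (auto simp: is_arg_min_def)
      ultimately show ?thesis using nonneg[of "xhat \<tau>"] by simp
    qed
    let ?r = "\<lambda>x. weighted_norm (\<Sigma> \<tau>) (x - xhat \<tau>)"
    have I\<tau>: "I \<tau> = neg_log_posterior \<epsilon> A F m0 \<Sigma>0 (y \<tau>) (c \<tau>) \<tau>" by (simp add: I_def)
    have \<Sigma>\<tau>: "\<Sigma> \<tau> = matrix_inv (hessian (I \<tau>) (xhat \<tau>))" by (simp add: \<Sigma>_def)
    note bounds = F_bounds[OF \<tau>0(1)]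
    note rem = laplace_remainder[where \<epsilon>=\<epsilon> and A=A and F=F and ?m0.0=m0 and ?S0.0=\<Sigma>0 and y="y \<tau>" and c="c \<tau>"
        and \<tau>=\<tau> and xh="xhat \<tau>" and ?C0.0=C0 and ?C1.0=C1 and ?C2.0=C2 and ?C3.0=C3 and M=M,
        folded I\<tau>, folded \<Sigma>\<tau>, OF F_C3 \<tau>0(2) zero nonneg hess_pos[OF \<tau>0(1)]]
    have up: "\<bar>I \<tau> x - (?r x)\<^sup>2 / 2\<bar> \<le> K \<tau> / 6 * ?r x ^ 3" for x
      using rem(1)[of x] bounds M_pos D3F_zero by (simp add: K_def V_def W_def)
    have up2: "\<bar>I \<tau> x - (?r x)\<^sup>2 / 2\<bar> \<le> \<tau> * B (a \<tau>) (b \<tau>) * (?r x)\<^sup>2" if "?r x \<ge> 1" for x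
      using rem(2)[of x] bounds M_pos D3F_zero \<tau>0(3) that by (simp add: B_def a_def b_def)
    have low: "\<delta> * ((?r x)\<^sup>2 / 2) \<le> I \<tau> x" for x
    proof -
      have r0: "0 \<le> ?r x" by (simp add: weighted_norm_def)
      have "\<bar>I \<tau> x - (?r x)\<^sup>2 / 2\<bar> \<le> \<eta> / 2 * (?r x)\<^sup>2"
      \<comment> \<open>Below 1 the cube of the distance is at most its square, so
        \<open>K \<tau> \<le> 3 * \<eta>\<close> suffices there.\<close>
      proof (cases "?r x \<ge> 1")
        case True
        have "\<tau> * B (a \<tau>) (b \<tau>) * (?r x)\<^sup>2 \<le> \<eta> / 2 * (?r x)\<^sup>2"
          using small(3)[OF \<tau>] by (intro mult_right_mono) auto
        with up2[OF True] show ?thesis by linarith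
      next
        case False
        have "K \<tau> / 6 * ?r x ^ 3 \<le> \<eta> / 2 * (?r x)\<^sup>2"
          using small(1,2)[OF \<tau>] False r0 \<eta> by (intro mult_mono power_decreasing) auto
        with up[of x] show ?thesis by linarith
      qed
      moreover have "\<delta> * ((?r x)\<^sup>2 / 2) = (?r x)\<^sup>2 / 2 - \<eta> / 2 * (?r x)\<^sup>2"
        by (simp add: \<eta>_def field_simps)
      ultimately show ?thesis by linarith
    qed
    have "I \<tau> \<in> borel_measurable borel"
      unfolding I_def by (rule neg_log_posterior_measurable[OF F_C3])
    from tv_dist_laplace_le[OF \<Sigma>[OF \<tau>0(1)] eps \<delta> small(1)[OF \<tau>] this up low]
    have "tv_dist (posterior \<epsilon> (I \<tau>)) (gaussian (xhat \<tau>) (\<epsilon> *\<^sub>R \<Sigma> \<tau>))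
      \<le> sqrt 2 / 3 * (Gamma (p + 3/2) / Gamma p) / exp (- 1) * K \<tau> * sqrt \<epsilon>"
      unfolding p_def[symmetric] \<delta>p .
    \<comment> \<open>Dividing by \<open>exp (- 1)\<close> produces the factor e, and
      \<open>sqrt 2 / 3\<close> is half of the \<open>2/3 * sqrt 2\<close> in
      \<open>C\<close>.\<close>
    also have "\<dots> = C * sqrt \<epsilon> * (K \<tau> / 2)"
      by (simp add: C_def p_def exp_minus field_simps)
    \<comment> \<open>\<open>K \<tau> / 2\<close> already contains
      \<open>W/2 * \<tau>\<^sup>2\<close> exactly and half of \<open>V \<tau> * \<tau>\<close>; the
      factor \<open>1 + \<epsilon>\<close> enters because it is at least 1.\<close>
    also have "\<dots> \<le> C * sqrt \<epsilon> * ((1 + \<epsilon>) * (V \<tau> * \<tau> + W/2 * \<tau>\<^sup>2))"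
    proof (intro mult_left_mono)
      have C0: "0 \<le> C" by (simp add: C_def)
      then show "0 \<le> C * sqrt \<epsilon>" using eps by simp
      have nn: "0 \<le> V \<tau> * \<tau>" "0 \<le> W * \<tau>\<^sup>2" using V0[of \<tau>] W0 \<tau>0(2) by simp_all
      have "K \<tau> / 2 \<le> 1 * (V \<tau> * \<tau> + W/2 * \<tau>\<^sup>2)"
        using nn by (simp add: K_def mult.commute)
      also have "\<dots> \<le> (1 + \<epsilon>) * (V \<tau> * \<tau> + W/2 * \<tau>\<^sup>2)"
        using nn eps by (intro mult_right_mono) auto
      finally show "K \<tau> / 2 \<le> (1 + \<epsilon>) * (V \<tau> * \<tau> + W/2 * \<tau>\<^sup>2)" .
    qed
    finally show ?thesis by (simp add: mult_ac)
  qed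
  have "bounded (V ` {0..\<tau>1})"
    unfolding bounded_iff
  \<comment> \<open>\<open>Vm\<close> bounds \<open>V\<close> at positive \<tau>; adding
    \<open>V 0\<close> covers the value at zero, about which the one-sided limits say
    nothing.\<close>
  proof (intro exI[of _ "V 0 + Vm"] ballI)
    fix v assume "v \<in> V ` {0..\<tau>1}"
    then obtain \<tau> where \<tau>: "0 \<le> \<tau>" "\<tau> \<le> \<tau>1" "v = V \<tau>" by auto
    then show "norm v \<le> V 0 + Vm"
      using V0[of \<tau>] V0[of 0] Vm0 pos(3)[of \<tau>] by (cases "\<tau> = 0") auto
  qed
  with tv \<tau>1 show ?thesis by (intro bexI[of _ \<tau>1]) auto
qed

end
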